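(* Let $1<t<3/2$ and let $\mathcal D$ be a dyadic system on $\mathbb T$. Let $p,q$ satisfy $\left(\frac1p,\frac1q\right)\in(0,1)^2$ and $\frac1q-\frac1p=2t-2$. Then for every $0<r<\infty$, the operator $\mathcal M_t^{\mathcal D}$ extends to a bounded operator from $L^{p,r}(\mathbb D)$ to $L^{q,r}(\mathbb D)$. In particular, $\mathcal M_t^{\mathcal D}:L^p(\mathbb D)\to L^{q,\infty}(\mathbb D)$ is bounded.
   Context: $\mathbb D$ is the open unit disc in $\mathbb C$, $dA$ is normalized area measure on $\mathbb D$, $|E|$ denotes the $dA$-measure of $E\subseteq\mathbb D$, and $L^p(\mathbb D)$ is taken with respect to $dA$. $\mathbb T$ is the unit circle with arc length normalized so that $|\mathbb T|=1$; $|I|$ is the normalized length of an arc $I$. A dyadic system on $\mathbb T$ is a collection of arcs $\mathcal D=\bigcup_{k\ge0}\mathcal D_k$ where each $\mathcal D_k$ consists of $2^k$ disjoint arcs of length $2^{-k}$ with union $\mathbb T$, and each arc of $\mathcal D_k$ is the union of two arcs of $\mathcal D_{k+1}$. The Carleson box of an arc $I\subseteq\mathbb T$ is $Q_I:=\{z\in\mathbb D: z/|z|\in I,\ 1-|I|\le|z|<1\}$ (the single point $z=0$ is a null set and plays no role). The dyadic hypersingular maximal operator is $$\mathcal M_t^{\mathcal D}f(z):=\sup_{I\in\mathcal D,\ z\in Q_I}\frac{1}{|Q_I|^t}\int_{Q_I}|f(w)|\,dA(w).$$ For $1\le p<\infty$ and $0<r<\infty$ the Lorentz space $L^{p,r}(\mathbb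 D)$ is defined by finiteness of $\|f\|_{L^{p,r}(\mathbb D)}:=\left(p\int_0^\infty\lambda^r|\{z\in\mathbb D:|f(z)|>\lambda\}|^{r/p}\frac{d\lambda}\lambda\right)^{1/r}$, and $\|f\|_{L^{q,\infty}(\mathbb D)}:=\sup_{\lambda>0}\lambda|\{z\in\mathbb D:|f(z)|>\lambda\}|^{1/q}$. *)

theory Defs
  imports "HOL-Analysis.Analysis"
begin

text \<open>Power of an extended nonnegative real, used only with exponents \<open>a > 0\<close>,
  so \<open>0\<close> goes to \<open>0\<close> and \<open>\<infinity>\<close> to \<open>\<infinity>\<close>.\<close>

definition epowr :: "ennreal \<Rightarrow> real \<Rightarrow> ennreal" where
  "epowr x a = (if x = \<infinity> then \<infinity> else ennreal (enn2real x powr a))"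

abbreviation disc :: "complex set" where
  "disc \<equiv> ball 0 1"

definition disc_area :: "complex measure" where
  "disc_area = scale_measure (ennreal (1 / pi)) (lebesgue_on disc)"

text \<open>Arcs of the unit circle may contain both, one or none of their endpoints.\<close>

definition is_arc :: "complex set \<Rightarrow> bool" where
  "is_arc I \<longleftrightarrow> (\<exists>J::real set. is_interval J \<and> I = (\<lambda>\<theta>. cis (2 * pi * \<theta>)) ` J)"

definition arc_measure :: "complex set \<Rightarrow> real" where
  "arc_measure I = measure lborel {\<theta>\<in>{0..<1}. cis (2 * pi * \<theta>) \<in> I}"

definition dyadic_system :: "complex set set \<Rightarrow> bool" where
  "dyadic_system \<D> \<longleftrightarrow> (\<exists>D :: nat \<Rightarrow> complex set set.
     \<D> = (\<Union>k. D k) \<and>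
     (\<forall>k. card (D k) = 2 ^ k \<and> disjoint (D k) \<and> \<Union>(D k) = sphere 0 1 \<and>
          (\<forall>I\<in>D k. is_arc I \<and> arc_measure I = 1 / 2 ^ k) \<and>
          (\<forall>I\<in>D k. \<exists>J\<in>D (Suc k). \<exists>K\<in>D (Suc k). J \<noteq> K \<and> I = J \<union> K)))"

text \<open>As \<open>0 / 0 = 0\<close> does not lie on the unit circle, the centre belongs to no box of an arc,
  and the maximal function below is \<open>0\<close> there.\<close>

definition carleson_box :: "complex set \<Rightarrow> complex set" where
  "carleson_box I = {z\<in>disc. z / of_real (norm z) \<in> I \<and> 1 - arc_measure I \<le> norm z}"

definition maximal_op :: "real \<Rightarrow> complex set set \<Rightarrow> (complex \<Rightarrow> complex) \<Rightarrow> complex \<Rightarrow> ennreal" where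
  "maximal_op t \<D> f z =
     (SUP I\<in>{I\<in>\<D>. z \<in> carleson_box I}.
        (\<integral>\<^sup>+w\<in>carleson_box I. ennreal (norm (f w)) \<partial>disc_area)
          / ennreal (measure disc_area (carleson_box I) powr t))"

text \<open>The (quasi-)norms depend on a function only through its modulus, so they are defined for
  \<open>[0,\<infinity>]\<close>-valued functions: this covers both \<open>|f|\<close> for complex-valued \<open>f\<close>
  and the maximal function.\<close>

definition lorentz_norm :: "real \<Rightarrow> real \<Rightarrow> (complex \<Rightarrow> ennreal) \<Rightarrow> ennreal" where
  "lorentz_norm p r g =
     epowr (ennreal p * (\<integral>\<^sup>+s\<in>{0<..}. ennreal (s powr r
              * measure disc_area {z\<in>disc. g z > ennreal s} powr (r / p) / s) \<partial>lborel)) (1 / r)"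

definition weak_norm :: "real \<Rightarrow> (complex \<Rightarrow> ennreal) \<Rightarrow> ennreal" where
  "weak_norm q g =
     (SUP s\<in>{0<..}. ennreal (s * measure disc_area {z\<in>disc. g z > ennreal s} powr (1 / q)))"

definition Lp_norm :: "real \<Rightarrow> (complex \<Rightarrow> ennreal) \<Rightarrow> ennreal" where
  "Lp_norm p g = epowr (\<integral>\<^sup>+z. epowr (g z) p \<partial>disc_area) (1 / p)"

text \<open>\<open>T\<close> maps the space of measurable functions of finite norm \<open>N\<close>
  boundedly into the one given by \<open>N'\<close>.\<close>

definition bounded_op ::
  "((complex \<Rightarrow> ennreal) \<Rightarrow> ennreal) \<Rightarrow> ((complex \<Rightarrow> ennreal) \<Rightarrow> ennreal) \<Rightarrow>
   ((complex \<Rightarrow> complex) \<Rightarrow> complex \<Rightarrow> ennreal) \<Rightarrow> bool" where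
  "bounded_op N N' T \<longleftrightarrow>
     (\<exists>C::real. C \<ge> 0 \<and>
       (\<forall>f \<in> borel_measurable disc_area. N (\<lambda>z. ennreal (norm (f z))) < \<infinity> \<longrightarrow>
          T f \<in> borel_measurable disc_area \<and> (AE z in disc_area. T f z < \<infinity>) \<and>
          N' (T f) \<le> ennreal C * N (\<lambda>z. ennreal (norm (f z)))))"

end

theory Submission
  imports Defs
begin

text \<open>A box \<open>Q\<close> of an arc \<open>I\<close> that contains \<open>z\<close> satisfies \<open>|I| \<ge> 1 - |z|\<close> and
  \<open>|Q| \<ge> c |I|\<^sup>2\<close>. Splitting \<open>|Q|\<^bsup>-t\<^esup> = |Q|\<^bsup>1-t\<^esup> |Q|\<^bsup>-1\<^esup>\<close> therefore gives the pointwise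
  bound \<open>M\<^sub>t f(z) \<le> C (1 - |z|)\<^bsup>-\<tau>\<^esup> M\<^sub>1 f(z)\<close> with \<open>\<tau> = 2t - 2\<close> (\<open>maximal_op_le_weight\<close>): the
  hypersingular operator is dominated by the ordinary dyadic maximal function times a weight. The weight
  lies in \<open>L\<^bsup>1/\<tau>,\<infinity>\<^esup>\<close>, because the annulus \<open>1 - |z| < \<delta>\<close> has area at most \<open>2\<delta>\<close>, and
  \<open>1/q = 1/p + \<tau>\<close> is exactly the exponent relation in O'Neil's version of Hoelder's inequality
  for Lorentz spaces. What remains is the boundedness of \<open>M\<^sub>1\<close> on \<open>L\<^bsup>p,r\<^esup>\<close>, which holds for all
  \<open>p > 1\<close> and \<open>r > 0\<close>.

  The Lorentz norm is a Mellin integral of a power of the distribution function, so both steps are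
  carried out on distribution functions, without rearrangements.

  The boxes of a dyadic system are nested or disjoint, hence \<open>M\<^sub>1\<close> is of weak type \<open>(1,1)\<close>
  (\<open>maximal_op_weak_type_1_1\<close>). Applied to the part of \<open>f\<close> above height \<open>s\<close>, this bounds
  the distribution function of \<open>M\<^sub>1 f\<close> at \<open>2 s\<close> by the sum over \<open>j\<close> of
  \<open>2\<^bsup>j+1\<^esup>\<close> times the distribution function of \<open>f\<close> at \<open>2\<^sup>j s\<close>; the discrete Hardy
  inequality \<open>mellin_hardy\<close> turns this into the Lorentz bound.

  For the product with the weight, removing the annulus \<open>1 - |z| < \<delta>\<close> gives
  \<open>\<phi>(s) \<le> 2 \<delta> + \<psi>(s \<delta>\<^sup>\<tau> / K)\<close> for the distribution functions \<open>\<phi>\<close> of \<open>M\<^sub>t f\<close> and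
  \<open>\<psi>\<close> of \<open>M\<^sub>1 f\<close>, for every \<open>\<delta>\<close>. Taking \<open>\<delta>\<close> comparable to \<open>\<phi>(s)\<close> makes the first
  term harmless, and \<open>mellin_product\<close> integrates the result. The same choice of \<open>\<delta>\<close>, together with
  the weak type \<open>(p,p)\<close> bound for \<open>M\<^sub>1\<close>, gives the estimate from \<open>L\<^sup>p\<close> to \<open>L\<^bsup>q,\<infinity>\<^esup>\<close>.\<close>

section \<open>Normalized area and Carleson boxes\<close>

lemma space_disc_area [simp]: "space disc_area = disc"
  by (simp add: disc_area_def space_scale_measure)

lemma sets_disc_area: "A \<in> sets disc_area \<longleftrightarrow> A \<in> sets lebesgue \<and> A \<subseteq> disc"
  by (auto simp: disc_area_def sets_restrict_space_iff)

lemma emeasure_disc_area: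
  assumes "A \<subseteq> disc"
  shows "emeasure disc_area A = ennreal (1 / pi) * emeasure lebesgue A"
  unfolding disc_area_def using assms by (simp add: emeasure_restrict_space)

lemma measure_disc_area:
  assumes "A \<subseteq> disc"
  shows "measure disc_area A = measure lebesgue A / pi"
  unfolding measure_def emeasure_disc_area[OF assms] by (simp add: enn2real_mult)

lemma measure_ball_complex: "0 \<le> r \<Longrightarrow> measure lebesgue (ball (c::complex) r) = pi * r\<^sup>2"
  by (simp add: measure_completion content_ball unit_ball_vol_2)

lemma measure_disc_area_disc: "measure disc_area disc = 1"
  using measure_ball_complex[of 1 0] by (simp add: measure_disc_area)

interpretation disc_area: finite_measure disc_area
proof (rule finite_measureI)
  have "emeasure lebesgue disc = ennreal pi" by (simp add: emeasure_ball unit_ball_vol_2)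
  then show "emeasure disc_area (space disc_area) \<noteq> \<infinity>"
    by (simp add: emeasure_disc_area ennreal_mult_eq_top_iff)
qed

lemma measure_near_circle_le:
  assumes "0 < \<delta>" "\<delta> \<le> 1"
  shows "measure disc_area {z\<in>disc. 1 - norm z < \<delta>} \<le> 2 * \<delta>"
proof -
  have c: "cball 0 (1 - \<delta>) \<subseteq> disc" using assms by auto
  have "{z\<in>disc. 1 - norm z < \<delta>} = disc - cball 0 (1 - \<delta>)" by auto
  moreover have "measure disc_area (disc - cball 0 (1 - \<delta>))
      = measure disc_area disc - measure disc_area (cball 0 (1 - \<delta>))"
    by (rule disc_area.finite_measure_Diff) (use c in \<open>auto simp: sets_disc_area\<close>)
  moreover have "measure disc_area (cball 0 (1 - \<delta>)) = (1 - \<delta>)\<^sup>2"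
    using assms c by (simp add: measure_disc_area measure_completion content_cball unit_ball_vol_2)
  ultimately have "measure disc_area {z\<in>disc. 1 - norm z < \<delta>} = 1 - (1 - \<delta>)\<^sup>2"
    by (simp add: measure_disc_area_disc)
  also have "\<dots> = 2 * \<delta> - \<delta>\<^sup>2" by (simp add: power2_eq_square algebra_simps)
  finally show ?thesis by simp
qed

text \<open>A continuous image of a Borel set need not be Borel, but a parameter interval is an open set and
  at most two more points, hence a countable union of compact sets, and so is its image.\<close>

lemma is_arc_borel:
  assumes "is_arc I"
  shows "I \<in> sets borel"
proof -
  define e where "e \<theta> = cis (2 * pi * \<theta>)" for \<theta> :: real
  have cont: "continuous_on S e" for S
    unfolding e_def by (intro continuous_intros)
  have e_compact: "e ` S \<in> sets borel" if "compact S" for S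
    using compact_continuous_image[OF cont that] by (intro borel_compact)
  have e_open: "e ` S \<in> sets borel" if S: "open S" for S
  proof -
    obtain C :: "nat \<Rightarrow> real set" where C: "\<And>n. compact (C n)" "\<Union>(range C) = S"
      by (rule open_Union_compact_subsets[OF S]) blast
    have "e ` S = (\<Union>n. e ` C n)" using C(2) by auto
    then show ?thesis using e_compact[OF C(1)] by auto
  qed
  have e_closed: "e ` S \<in> sets borel" if S: "closed S" for S
  proof -
    obtain C :: "nat \<Rightarrow> real set" where C: "\<And>n. compact (C n)" "\<Union>(range C) = S"
      by (rule closed_Union_compact_subsets[OF S]) blast
    have "e ` S = (\<Union>n. e ` C n)" using C(2) by auto
    then show ?thesis using e_compact[OF C(1)] by auto
  qed
  have e_Un: "e ` (interior S \<union> T) \<in> sets borel" if "finite T" for S T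
    using e_open[of "interior S"] e_compact[of T] that by (simp add: image_Un finite_imp_compact sets.Un)
  obtain J where J: "is_interval J" "I = e ` J"
    using assms unfolding is_arc_def e_def by blast
  obtain a b where "J = {} \<or> J = UNIV \<or> J = {..<b} \<or> J = {..b} \<or> J = {a<..} \<or> J = {a..} \<or>
      J = {a<..<b} \<or> J = {a<..b} \<or> J = {a..<b} \<or> J = {a..b}"
    using interval_cases[of J] J(1) mem_is_interval_1_I[of J] by metis
  then have "J - interior J \<subseteq> {a, b}"
    by (elim disjE) (auto simp: interior_open)
  then have "finite (J - interior J)" by (rule finite_subset) auto
  moreover have "J = interior J \<union> (J - interior J)" using interior_subset by auto
  ultimately show ?thesis using J(2) e_Un by metis
qed

lemma carleson_box_sets:
  assumes "is_arc I"
  shows "carleson_box I \<in> sets disc_area"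
proof -
  note [measurable] = is_arc_borel[OF assms]
  have "carleson_box I = disc \<inter> (\<lambda>z. z / of_real (norm z)) -` I \<inter> {z. 1 - arc_measure I \<le> norm z}"
    by (auto simp: carleson_box_def)
  moreover have "(\<lambda>z::complex. z / of_real (norm z)) -` I \<in> sets borel"
  proof -
    have "(\<lambda>z::complex. z / of_real (norm z)) \<in> borel_measurable borel" by measurable
    from measurable_sets[OF this is_arc_borel[OF assms]] show ?thesis by simp
  qed
  moreover have "{z::complex. 1 - arc_measure I \<le> norm z} \<in> sets borel" by measurable
  ultimately have "carleson_box I \<in> sets borel" by auto
  then show ?thesis by (auto simp: sets_disc_area carleson_box_def)
qed

text \<open>The loss of the factor \<open>5\<close> allows a crude argument: if all parameters lie within \<open>\<kappa>\<close> of one of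
  them, then modulo \<open>1\<close> they meet \<open>[0,1)\<close> in at most two translates of an interval of length
  \<open>2\<kappa>\<close>, so the arc has length at most \<open>4\<kappa>\<close>.\<close>

lemma is_arc_long_interval:
  assumes "is_arc I" "0 < arc_measure I" "arc_measure I \<le> 1"
  obtains a b where "b - a > arc_measure I / 5" "\<And>\<theta>. a \<le> \<theta> \<Longrightarrow> \<theta> \<le> b \<Longrightarrow> cis (2 * pi * \<theta>) \<in> I"
proof -
  define \<kappa> where "\<kappa> = arc_measure I / 5"
  obtain J where J: "is_interval J" "I = (\<lambda>\<theta>. cis (2 * pi * \<theta>)) ` J"
    using assms(1) unfolding is_arc_def by blast
  have "\<exists>a\<in>J. \<exists>b\<in>J. b - a > \<kappa>"
  proof (rule ccontr)
    assume "\<not> ?thesis"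
    then have close: "\<bar>x - y\<bar> \<le> \<kappa>" if "x \<in> J" "y \<in> J" for x y
      using that by (force simp: abs_le_iff)
    have "J \<noteq> {}" using assms(2) J(2) by (auto simp: arc_measure_def)
    then obtain x where x: "x \<in> J" by blast
    define m where "m = \<lceil>- \<kappa> - x\<rceil>"
    have m: "- \<kappa> - x \<le> m" unfolding m_def by linarith
    have \<kappa>: "\<kappa> \<le> 1 / 5" using assms(3) by (simp add: \<kappa>_def)
    let ?A = "{x + m - \<kappa> .. x + m + \<kappa>}" and ?B = "{x + m + 1 - \<kappa> .. x + m + 1 + \<kappa>}"
    have "{\<theta>\<in>{0..<1}. cis (2 * pi * \<theta>) \<in> I} \<subseteq> ?A \<union> ?B"
    proof safe
      fix \<theta> :: real assume \<theta>: "\<theta> \<in> {0..<1}" "cis (2 * pi * \<theta>) \<in> I" "\<theta> \<notin> ?B"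
      then obtain \<eta> where \<eta>: "\<eta> \<in> J" "cis (2 * pi * \<theta>) = cis (2 * pi * \<eta>)" using J by auto
      then obtain n :: int where "2 * pi * \<theta> = 2 * pi * \<eta> + 2 * pi * n"
        unfolding complex_eq_iff using sin_cos_eq_iff[of "2 * pi * \<theta>" "2 * pi * \<eta>"] by auto
      then have "2 * pi * \<theta> = 2 * pi * (\<eta> + n)" by (simp add: algebra_simps)
      then have n: "\<theta> = \<eta> + n" by simp
      have d: "\<bar>\<eta> - x\<bar> \<le> \<kappa>" using close \<eta>(1) x by blast
      have "real_of_int n \<ge> - \<kappa> - x" using d n \<theta> by auto
      then have "n \<ge> m" unfolding m_def by linarith
      moreover have "real_of_int n < m + 2"
        using d n \<theta>(1) m \<kappa> unfolding atLeastLessThan_iff by linarith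
      then have "n < m + 2" by linarith
      ultimately have "n = m \<or> n = m + 1" by linarith
      then show "\<theta> \<in> ?A" using d n \<theta>(3) by (auto simp: abs_le_iff)
    qed
    then have "emeasure lborel {\<theta>\<in>{0..<1}. cis (2 * pi * \<theta>) \<in> I} \<le> emeasure lborel (?A \<union> ?B)"
      by (rule emeasure_mono) auto
    also have "\<dots> \<le> emeasure lborel ?A + emeasure lborel ?B"
      by (rule emeasure_subadditive) auto
    also have "\<dots> = ennreal (4 * \<kappa>)"
      using assms by (simp add: \<kappa>_def ennreal_plus[symmetric] del: ennreal_plus)
    finally have "arc_measure I \<le> 4 * \<kappa>"
      using assms unfolding arc_measure_def measure_def \<kappa>_def[unfolded arc_measure_def measure_def]
      by (intro enn2real_leI) auto
    then show False using assms by (simp add: \<kappa>_def)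
  qed
  then obtain a b where ab: "a \<in> J" "b \<in> J" "b - a > \<kappa>" by blast
  show ?thesis
  proof
    show "b - a > arc_measure I / 5" using ab by (simp add: \<kappa>_def)
    show "cis (2 * pi * \<theta>) \<in> I" if "a \<le> \<theta>" "\<theta> \<le> b" for \<theta>
      using that ab J mem_is_interval_1_I[OF J(1) ab(1,2)] by auto
  qed
qed

text \<open>The box of an arc of length \<open>l\<close> contains a Euclidean disc of radius \<open>l / 8\<close>, centred at modulus
  \<open>1 - l / 2\<close> above the middle of the parameter interval just found; its normalized area is
  \<open>l\<^sup>2 / 64\<close>.\<close>

lemma measure_carleson_box_ge:
  assumes "is_arc I" "0 < arc_measure I" "arc_measure I \<le> 1"
  shows "(arc_measure I)\<^sup>2 / 64 \<le> measure disc_area (carleson_box I)"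
proof -
  define l where "l = arc_measure I"
  have l: "0 < l" "l \<le> 1" using assms by (auto simp: l_def)
  obtain a b where ab: "b - a > l / 5" "\<And>\<theta>. a \<le> \<theta> \<Longrightarrow> \<theta> \<le> b \<Longrightarrow> cis (2 * pi * \<theta>) \<in> I"
    using is_arc_long_interval[OF assms] unfolding l_def by blast
  define e where "e = cis (pi * (a + b))"
  define c where "c = of_real (1 - l / 2) * e"
  have ne: "norm e = 1" "e \<noteq> 0" unfolding e_def by auto
  have "ball c (l / 8) \<subseteq> carleson_box I"
  proof
    fix z assume "z \<in> ball c (l / 8)"
    then have z: "norm (z - c) < l / 8" by (simp add: dist_norm norm_minus_commute)
    have nc: "norm c = 1 - l / 2" using l ne(1) unfolding c_def norm_mult norm_of_real by simp
    have nz: "1 - l \<le> norm z" "norm z < 1"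
      using z nc norm_triangle_ineq2[of z c] norm_triangle_ineq2[of c z] l
      by (auto simp: norm_minus_commute)
    \<comment> \<open>Rotate and rescale so that the centre becomes \<open>1\<close>; then the argument of the point is
      controlled by the tangent.\<close>
    define u where "u = z / c"
    have c0: "c \<noteq> 0" using nc l by auto
    have "norm (u - 1) = norm (z - c) / norm c" using c0 unfolding u_def
      by (metis diff_divide_distrib divide_self norm_divide)
    also have "\<dots> \<le> norm (z - c) / (1 / 2)"
      using nc l by (intro divide_left_mono) auto
    finally have u1: "norm (u - 1) < l / 4" using z by simp
    have im: "\<bar>Im u\<bar> < l / 4" using abs_Im_le_cmod[of "u - 1"] u1 by simp
    have re: "Re u > 3 / 4" using abs_Re_le_cmod[of "u - 1"] u1 l by simp
    have "\<bar>Arg u\<bar> = arctan \<bar>Im u / Re u\<bar>"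
      using re by (subst arg_conv_arctan) (auto simp: abs_if arctan_minus[symmetric] simp del: arctan_minus)
    also have "\<dots> \<le> \<bar>Im u\<bar> / Re u" using arctan_le_self[of "\<bar>Im u / Re u\<bar>"] re by simp
    also have "\<dots> \<le> \<bar>Im u\<bar> / (3 / 4)" using re by (intro divide_left_mono) auto
    also have "\<dots> < l / 3" using im by simp
    also have "\<dots> \<le> pi * (l / 5)" using pi_gt3 l by (simp add: field_simps)
    finally have A: "\<bar>Arg u\<bar> < pi * (l / 5)" .
    define v where "v = Arg u / (2 * pi)"
    define \<theta> where "\<theta> = (a + b) / 2 + v"
    have "\<bar>v\<bar> < (l / 5) / 2" using A unfolding v_def by (simp add: abs_divide field_simps)
    then have "a \<le> \<theta> \<and> \<theta> \<le> b" using ab(1) unfolding \<theta>_def abs_less_iff by (simp add: field_simps)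
    then have "cis (2 * pi * \<theta>) \<in> I" by (intro ab(2)) auto
    also have "cis (2 * pi * \<theta>) = e * cis (Arg u)"
    proof -
      have "2 * pi * \<theta> = pi * (a + b) + Arg u" unfolding \<theta>_def v_def by (simp add: distrib_left)
      then show ?thesis by (simp add: e_def cis_mult)
    qed
    also have "\<dots> = e * sgn u" using re by (subst cis_Arg) auto
    also have "\<dots> = z / of_real (norm z)"
    proof -
      have "z = of_real (1 - l / 2) * (e * u)" using c0 unfolding u_def mult.assoc[symmetric] c_def[symmetric] by simp
      moreover have "norm z = (1 - l / 2) * norm u" using nc l unfolding u_def by (simp add: norm_divide)
      moreover have "of_real (1 - l / 2) \<noteq> (0::complex)" using l unfolding of_real_eq_0_iff by simp
      ultimately show ?thesis by (simp add: sgn_eq del: of_real_diff of_real_divide)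
    qed
    finally show "z \<in> carleson_box I" using nz unfolding carleson_box_def l_def by simp
  qed
  moreover have "measure disc_area (ball c (l / 8)) = l\<^sup>2 / 64"
  proof -
    have "ball c (l / 8) \<subseteq> disc" using calculation by (auto simp: carleson_box_def)
    then have "measure disc_area (ball c (l / 8)) = pi * (l / 8)\<^sup>2 / pi"
      using l measure_ball_complex[of "l / 8" c] by (subst measure_disc_area) auto
    then show ?thesis by (simp add: power_divide)
  qed
  ultimately show ?thesis
    using disc_area.finite_measure_mono[OF _ carleson_box_sets[OF assms(1)], of "ball c (l / 8)"]
    by (simp add: l_def)
qed

section \<open>The weak type inequality for the averages over Carleson boxes\<close>

text \<open>The enumeration by generations hidden in the definition of a dyadic system.\<close>

definition level_arcs :: "(nat \<Rightarrow> complex set set) \<Rightarrow> bool" where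
  "level_arcs D \<longleftrightarrow>
     (\<forall>k. card (D k) = 2 ^ k \<and> disjoint (D k) \<and> \<Union>(D k) = sphere 0 1 \<and>
          (\<forall>I\<in>D k. is_arc I \<and> arc_measure I = 1 / 2 ^ k) \<and>
          (\<forall>I\<in>D k. \<exists>J\<in>D (Suc k). \<exists>K\<in>D (Suc k). J \<noteq> K \<and> I = J \<union> K))"

lemma level_arcsD:
  assumes "level_arcs D"
  shows "card (D k) = 2 ^ k" "disjoint (D k)" "\<Union>(D k) = sphere 0 1"
    and "I \<in> D k \<Longrightarrow> is_arc I" "I \<in> D k \<Longrightarrow> arc_measure I = 1 / 2 ^ k"
    and "I \<in> D k \<Longrightarrow> \<exists>J\<in>D (Suc k). \<exists>K\<in>D (Suc k). J \<noteq> K \<and> I = J \<union> K"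
  using assms[unfolded level_arcs_def, rule_format, of k] by auto

lemma dyadic_system_levels:
  assumes "dyadic_system \<D>"
  obtains D where "\<D> = (\<Union>k. D k)" "level_arcs D"
proof -
  from assms obtain D where "\<D> = (\<Union>k. D k) \<and> level_arcs D"
    unfolding dyadic_system_def level_arcs_def[symmetric] by (rule exE)
  then show ?thesis using that by (elim conjE)
qed

lemma dyadic_arc:
  assumes "dyadic_system \<D>" "I \<in> \<D>"
  shows "is_arc I" "0 < arc_measure I" "arc_measure I \<le> 1"
proof -
  obtain D where "\<D> = (\<Union>k. D k)" "level_arcs D"
    by (rule dyadic_system_levels[OF assms(1)])
  moreover from this obtain k where "I \<in> D k" using assms(2) by blast
  ultimately have D: "I \<in> D k" "level_arcs D" by simp_all
  show "is_arc I" using level_arcsD(4)[OF D(2,1)] .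
  have "arc_measure I = 1 / 2 ^ k" using level_arcsD(5)[OF D(2,1)] .
  then show "0 < arc_measure I" "arc_measure I \<le> 1" by simp_all
qed

lemma countable_dyadic_system:
  assumes "dyadic_system \<D>"
  shows "countable \<D>"
proof -
  obtain D where D: "\<D> = (\<Union>k. D k)" "level_arcs D"
    by (rule dyadic_system_levels[OF assms])
  have "finite (D k)" for k
    by (rule card_ge_0_finite) (simp add: level_arcsD(1)[OF D(2)])
  then show ?thesis by (simp add: D(1) countable_finite)
qed

text \<open>Each arc of the next generation meets some arc of the present one, and that arc is a union of two arcs
  of the next generation; by disjointness one of these two is the given arc.\<close>

lemma dyadic_ancestor:
  assumes "level_arcs D" "K \<in> D (j + n)"
  shows "\<exists>I\<in>D j. K \<subseteq> I"
  using assms(2)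
proof (induction n arbitrary: K)
  case (Suc n)
  have K: "K \<in> D (Suc (j + n))" using Suc.prems by simp
  have "K \<noteq> {}"
    using level_arcsD(5)[OF assms(1) K] by (auto simp: arc_measure_def)
  then obtain x where x: "x \<in> K" by blast
  then have "x \<in> \<Union>(D (j + n))"
    using K level_arcsD(3)[OF assms(1), of "Suc (j + n)"] level_arcsD(3)[OF assms(1), of "j + n"] by blast
  then obtain I where I: "I \<in> D (j + n)" "x \<in> I" by blast
  obtain J where J: "J \<in> D (Suc (j + n))" "x \<in> J" "J \<subseteq> I"
    using level_arcsD(6)[OF assms(1) I(1)] I(2) by blast
  have "K = J" using disjointD[OF level_arcsD(2)[OF assms(1)] K J(1)] J(2) x by blast
  then have "K \<subseteq> I" using J(3) by simp
  then show ?case using Suc.IH[OF I(1)] by blast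
qed auto

lemma carleson_box_mono:
  assumes "I \<subseteq> J" "arc_measure I \<le> arc_measure J"
  shows "carleson_box I \<subseteq> carleson_box J"
  using assms by (auto simp: carleson_box_def)

lemma dyadic_boxes_nested:
  assumes "dyadic_system \<D>" "I \<in> \<D>" "J \<in> \<D>"
  shows "carleson_box I \<subseteq> carleson_box J \<or> carleson_box J \<subseteq> carleson_box I \<or>
         carleson_box I \<inter> carleson_box J = {}"
proof -
  obtain D where D: "\<D> = (\<Union>k. D k)" "level_arcs D"
    by (rule dyadic_system_levels[OF assms(1)])
  have *: "carleson_box K \<subseteq> carleson_box L \<or> carleson_box L \<inter> carleson_box K = {}"
    if KL: "L \<in> D j" "K \<in> D (j + n)" for K L j n
  proof -
    obtain L' where L': "L' \<in> D j" "K \<subseteq> L'" using dyadic_ancestor[OF D(2) KL(2)] by blast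
    show ?thesis
    proof (cases "L = L'")
      case True
      have "arc_measure K = 1 / 2 ^ (j + n)" "arc_measure L = 1 / 2 ^ j"
        using level_arcsD(5)[OF D(2)] KL by blast+
      then have "arc_measure K \<le> arc_measure L"
        by (simp add: power_increasing frac_le)
      then show ?thesis using L' True carleson_box_mono by blast
    next
      case False
      have "L \<inter> L' = {}" using disjointD[OF level_arcsD(2)[OF D(2)] KL(1) L'(1) False] .
      then have "L \<inter> K = {}" using L'(2) by blast
      then show ?thesis by (auto simp: carleson_box_def)
    qed
  qed
  obtain i j where ij: "I \<in> D i" "J \<in> D j" using assms(2,3) D(1) by blast
  show ?thesis
  proof (cases "i \<le> j")
    case True
    then have "J \<in> D (i + (j - i))" using ij by simp
    from *[OF ij(1) this] show ?thesis by blast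
  next
    case False
    then have "I \<in> D (j + (i - j))" using ij by simp
    from *[OF ij(2) this] show ?thesis by blast
  qed
qed

text \<open>Only the maximal members of the family matter: they are pairwise disjoint and have the same union, so
  the inequality may be summed over them.\<close>

lemma nested_family_bound:
  fixes \<nu> :: "'a measure"
  assumes "finite F" "F \<subseteq> sets \<mu>" "sets \<nu> = sets \<mu>"
    and nested: "\<And>A B. A \<in> F \<Longrightarrow> B \<in> F \<Longrightarrow> A \<subseteq> B \<or> B \<subseteq> A \<or> A \<inter> B = {}"
    and le: "\<And>A. A \<in> F \<Longrightarrow> c * emeasure \<mu> A \<le> emeasure \<nu> A"
  shows "c * emeasure \<mu> (\<Union>F) \<le> emeasure \<nu> (space \<nu>)"
proof -
  define G where "G = {A\<in>F. \<forall>B\<in>F. A \<subseteq> B \<longrightarrow> A = B}"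
  have G: "finite G" "G \<subseteq> F" using assms(1) by (auto simp: G_def)
  have dis: "disjoint_family_on (\<lambda>A. A) G"
    unfolding disjoint_family_on_def
  proof (intro ballI impI)
    fix A B assume AB: "A \<in> G" "B \<in> G" "A \<noteq> B"
    then have "\<not> A \<subseteq> B" "\<not> B \<subseteq> A" unfolding G_def by auto
    then show "A \<inter> B = {}" using nested[of A B] AB(1,2) G(2) by auto
  qed
  have "\<exists>B\<in>G. A \<subseteq> B" if "A \<in> F" for A
    using finite_has_maximal2[OF assms(1) that] unfolding G_def by blast
  then have "\<Union>F = \<Union>G" using G(2) by blast
  moreover have "(\<Sum>A\<in>G. emeasure \<mu> A) = emeasure \<mu> (\<Union>A\<in>G. A)"
    using G assms(2) dis by (intro sum_emeasure) auto
  ultimately have "c * emeasure \<mu> (\<Union>F) = c * (\<Sum>A\<in>G. emeasure \<mu> A)" by simp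
  also have "\<dots> \<le> (\<Sum>A\<in>G. emeasure \<nu> A)"
    unfolding sum_distrib_left using le G(2) by (intro sum_mono) auto
  also have "\<dots> = emeasure \<nu> (\<Union>A\<in>G. A)"
    using G assms(2,3) dis by (intro sum_emeasure) auto
  also have "\<dots> \<le> emeasure \<nu> (space \<nu>)" by (rule emeasure_space)
  finally show ?thesis .
qed

text \<open>As a supremum over a set of arcs that does not depend on \<open>z\<close>, the maximal function is visibly
  measurable.\<close>

lemma maximal_op_eq_SUP:
  "maximal_op t \<D> f z = (SUP I\<in>\<D>.
     (\<integral>\<^sup>+w\<in>carleson_box I. ennreal (norm (f w)) \<partial>disc_area)
       / ennreal (measure disc_area (carleson_box I) powr t) * indicator (carleson_box I) z)"
  (is "_ = (SUP I\<in>\<D>. ?a I / ?m I * indicator (carleson_box I) z)")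
  unfolding maximal_op_def
proof (rule antisym)
  show "(SUP I\<in>{I\<in>\<D>. z \<in> carleson_box I}. ?a I / ?m I) \<le> (SUP I\<in>\<D>. ?a I / ?m I * indicator (carleson_box I) z)"
  proof (rule SUP_least)
    fix I assume "I \<in> {I\<in>\<D>. z \<in> carleson_box I}"
    then show "?a I / ?m I \<le> (SUP I\<in>\<D>. ?a I / ?m I * indicator (carleson_box I) z)"
      by (intro SUP_upper2[of I]) auto
  qed
  show "(SUP I\<in>\<D>. ?a I / ?m I * indicator (carleson_box I) z) \<le> (SUP I\<in>{I\<in>\<D>. z \<in> carleson_box I}. ?a I / ?m I)"
  proof (rule SUP_least)
    fix I assume I: "I \<in> \<D>"
    show "?a I / ?m I * indicator (carleson_box I) z \<le> (SUP I\<in>{I\<in>\<D>. z \<in> carleson_box I}. ?a I / ?m I)"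
    proof (cases "z \<in> carleson_box I")
      case True
      then show ?thesis using I by (intro SUP_upper2[of I]) auto
    qed simp
  qed
qed

lemma maximal_op_measurable:
  assumes "dyadic_system \<D>"
  shows "maximal_op t \<D> f \<in> borel_measurable disc_area"
proof -
  have [measurable]: "carleson_box I \<in> sets disc_area" if "I \<in> \<D>" for I
    using carleson_box_sets dyadic_arc(1)[OF assms that] .
  show ?thesis
    unfolding maximal_op_eq_SUP[abs_def]
    by (intro borel_measurable_SUP countable_dyadic_system[OF assms]) measurable
qed

text \<open>The superlevel set is covered by the boxes on which the average of \<open>|f|\<close> is at least \<open>s\<close>. There
  may be infinitely many such boxes, so the union is exhausted by finite subfamilies, to which the
  bound for nested families applies.\<close>

lemma maximal_op_weak_type_1_1:
  assumes \<D>: "dyadic_system \<D>" and f: "f \<in> borel_measurable disc_area" and s: "0 < s"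
  shows "ennreal s * emeasure disc_area {z\<in>disc. maximal_op 1 \<D> f z > ennreal s}
           \<le> (\<integral>\<^sup>+z. ennreal (norm (f z)) \<partial>disc_area)"
proof -
  define \<nu> where "\<nu> = density disc_area (\<lambda>z. ennreal (norm (f z)))"
  define F where "F = {I\<in>\<D>. ennreal s * emeasure disc_area (carleson_box I) \<le> emeasure \<nu> (carleson_box I)}"
  have meas: "carleson_box I \<in> sets disc_area" if "I \<in> \<D>" for I
    using carleson_box_sets dyadic_arc(1)[OF \<D> that] .
  have fm: "(\<lambda>z. ennreal (norm (f z))) \<in> borel_measurable disc_area" using f by measurable
  have sub: "{z\<in>disc. maximal_op 1 \<D> f z > ennreal s} \<subseteq> (\<Union>I\<in>F. carleson_box I)"
  proof safe
    fix z assume "maximal_op 1 \<D> f z > ennreal s"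
    then obtain I where I: "I \<in> \<D>" "z \<in> carleson_box I" and
      gt: "ennreal s < (\<integral>\<^sup>+w\<in>carleson_box I. ennreal (norm (f w)) \<partial>disc_area)
          / ennreal (measure disc_area (carleson_box I) powr 1)"
      unfolding maximal_op_def less_SUP_iff by blast
    have pos: "measure disc_area (carleson_box I) > 0"
      using measure_carleson_box_ge[OF dyadic_arc[OF \<D> I(1)]] dyadic_arc(2)[OF \<D> I(1)]
      by (smt (verit) zero_less_divide_iff zero_less_power)
    have e: "emeasure \<nu> (carleson_box I) = (\<integral>\<^sup>+w\<in>carleson_box I. ennreal (norm (f w)) \<partial>disc_area)"
      unfolding \<nu>_def using meas[OF I(1)] fm by (rule emeasure_density[rotated])
    have "ennreal s * ennreal (measure disc_area (carleson_box I))
        \<le> emeasure \<nu> (carleson_box I) / ennreal (measure disc_area (carleson_box I)) * ennreal (measure disc_area (carleson_box I))"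
      using gt pos unfolding e by (intro mult_right_mono) auto
    also have "\<dots> = emeasure \<nu> (carleson_box I)"
      using pos by (simp add: ennreal_divide_times ennreal_mult_divide_eq)
    finally have "I \<in> F" using I(1) by (simp add: F_def disc_area.emeasure_eq_measure)
    then show "z \<in> (\<Union>I\<in>F. carleson_box I)" using I(2) by blast
  qed
  have bound: "ennreal s * emeasure disc_area (\<Union>I\<in>F'. carleson_box I) \<le> emeasure \<nu> (space \<nu>)"
    if "finite F'" "F' \<subseteq> F" for F'
  proof (rule nested_family_bound)
    show "A \<subseteq> B \<or> B \<subseteq> A \<or> A \<inter> B = {}"
      if "A \<in> carleson_box ` F'" "B \<in> carleson_box ` F'" for A B
      using dyadic_boxes_nested[OF \<D>] that \<open>F' \<subseteq> F\<close> unfolding F_def by blast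
  qed (use that meas in \<open>auto simp: F_def \<nu>_def\<close>)
  show ?thesis
  proof (cases "F = {}")
    case True
    then have "{z\<in>disc. maximal_op 1 \<D> f z > ennreal s} = {}" using sub by simp
    then show ?thesis by (simp only: emeasure_empty mult_zero_right zero_le)
  next
    case False
    have "countable F"
      by (rule countable_subset[OF _ countable_dyadic_system[OF \<D>]]) (auto simp: F_def)
    then have e: "range (from_nat_into F) = F" using False by (intro range_from_nat_into)
    define e where "e = from_nat_into F"
    note e = e[folded e_def]
    define U where "U n = (\<Union>I\<in>e ` {..n}. carleson_box I)" for n
    have U: "range U \<subseteq> sets disc_area" "incseq U" "(\<Union>n. U n) = (\<Union>I\<in>F. carleson_box I)"
    proof -
      show "range U \<subseteq> sets disc_area"
      proof (rule image_subsetI)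
        fix n
        have "e i \<in> \<D>" for i using e unfolding F_def by blast
        then show "U n \<in> sets disc_area" unfolding U_def by (intro sets.finite_UN meas) auto
      qed
      show "incseq U" unfolding U_def incseq_def by (intro allI impI UN_mono image_mono) auto
      have "(\<Union>n. U n) = (\<Union>I\<in>range e. carleson_box I)" unfolding U_def by blast
      then show "(\<Union>n. U n) = (\<Union>I\<in>F. carleson_box I)" by (simp only: e)
    qed
    have "ennreal s * emeasure disc_area {z\<in>disc. maximal_op 1 \<D> f z > ennreal s}
        \<le> ennreal s * emeasure disc_area (\<Union>n. U n)"
    proof (intro mult_left_mono emeasure_mono)
      show "(\<Union>n. U n) \<in> sets disc_area" using U(1) by (intro sets.countable_UN) auto
    qed (use sub U(3) in simp_all)
    also have "\<dots> = (SUP n. ennreal s * emeasure disc_area (U n))"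
      unfolding SUP_emeasure_incseq[OF U(1,2), symmetric] by (rule SUP_mult_left_ennreal)
    also have "\<dots> \<le> emeasure \<nu> (space \<nu>)"
    proof (rule SUP_least)
      fix n
      have "e ` {..n} \<subseteq> F" using e by blast
      then show "ennreal s * emeasure disc_area (U n) \<le> emeasure \<nu> (space \<nu>)"
        unfolding U_def by (intro bound) auto
    qed
    also have "\<dots> = (\<integral>\<^sup>+z. ennreal (norm (f z)) \<partial>disc_area)"
      unfolding \<nu>_def space_density emeasure_density[OF fm sets.top]
      by (intro nn_integral_cong) simp
    finally show ?thesis .
  qed
qed

section \<open>Inequalities for Mellin integrals\<close>

text \<open>This is the Mellin transform of \<open>h\<close> at \<open>r\<close>. Up to the factor \<open>p\<close>, the Lorentz norm
  is a power of its value at a power of the distribution function.\<close>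

definition mellin :: "real \<Rightarrow> (real \<Rightarrow> real) \<Rightarrow> ennreal" where
  "mellin r h = (\<integral>\<^sup>+s\<in>{0<..}. ennreal (s powr r * h s / s) \<partial>lborel)"

lemma mellin_cmult:
  assumes [measurable]: "h \<in> borel_measurable borel" and "0 \<le> c"
  shows "mellin r (\<lambda>s. c * h s) = ennreal c * mellin r h"
proof -
  have "mellin r (\<lambda>s. c * h s)
      = (\<integral>\<^sup>+s. ennreal c * (ennreal (s powr r * h s / s) * indicator {0<..} s) \<partial>lborel)"
    unfolding mellin_def using assms(2)
    by (intro nn_integral_cong) (auto simp: ennreal_mult'[symmetric] mult_ac split: split_indicator)
  also have "\<dots> = ennreal c * mellin r h"
    unfolding mellin_def by (intro nn_integral_cmult) measurable
  finally show ?thesis .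
qed

lemma mellin_scale:
  assumes [measurable]: "h \<in> borel_measurable borel" and c: "0 < c"
  shows "mellin r (\<lambda>s. h (c * s)) = ennreal (c powr - r) * mellin r h"
proof -
  have "mellin r h = ennreal \<bar>c\<bar> * (\<integral>\<^sup>+s. ennreal ((0 + c * s) powr r * h (0 + c * s) / (0 + c * s))
      * indicator {0<..} (0 + c * s) \<partial>lborel)"
    unfolding mellin_def using c by (intro nn_integral_real_affine) auto
  also have "\<dots> = (\<integral>\<^sup>+s. ennreal c * (ennreal ((0 + c * s) powr r * h (0 + c * s) / (0 + c * s))
      * indicator {0<..} (0 + c * s)) \<partial>lborel)"
    using c by (subst nn_integral_cmult) auto
  also have "\<dots> = mellin r (\<lambda>s. c powr r * h (c * s))"
    unfolding mellin_def using c
    by (intro nn_integral_cong)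
       (auto simp: ennreal_mult'[symmetric] powr_mult zero_less_mult_iff mult_ac split: split_indicator)
  also have "\<dots> = ennreal (c powr r) * mellin r (\<lambda>s. h (c * s))"
    using c by (intro mellin_cmult) auto
  finally show ?thesis
    using c by (simp add: mult.assoc[symmetric] ennreal_mult'[symmetric] powr_add[symmetric])
qed

text \<open>The index \<open>k\<close> may depend on \<open>s\<close>. Powers of distribution functions are bounded in this way by
  a single member of a countable family: unlike a bound by the sum of the family, such a bound can be raised
  to any positive power.\<close>

lemma mellin_le_suminf:
  fixes g :: "nat \<Rightarrow> real \<Rightarrow> real"
  assumes meas: "\<And>k. g k \<in> borel_measurable borel" and nonneg: "\<And>k s. 0 \<le> g k s"
    and ex: "\<And>s. 0 < s \<Longrightarrow> \<exists>k. h s \<le> g k s"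
  shows "mellin r h \<le> (\<Sum>k. mellin r (g k))"
proof -
  note [measurable] = meas
  have "mellin r h \<le> (\<integral>\<^sup>+s. (\<Sum>k. ennreal (s powr r * g k s / s) * indicator {0<..} s) \<partial>lborel)"
    unfolding mellin_def
  proof (rule nn_integral_mono)
    fix s :: real
    show "ennreal (s powr r * h s / s) * indicator {0<..} s
        \<le> (\<Sum>k. ennreal (s powr r * g k s / s) * indicator {0<..} s)"
    proof (cases "0 < s")
      case True
      then obtain k where "h s \<le> g k s" using ex by blast
      then have "ennreal (s powr r * h s / s) * indicator {0<..} s
          \<le> ennreal (s powr r * g k s / s) * indicator {0<..} s"
        using True by (auto intro!: ennreal_leI divide_right_mono mult_left_mono)
      also have "\<dots> = (\<Sum>j\<in>{k}. ennreal (s powr r * g j s / s) * indicator {0<..} s)"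
        by (simp del: sum_mult_indicator)
      also have "\<dots> \<le> (\<Sum>k. ennreal (s powr r * g k s / s) * indicator {0<..} s)"
        by (rule sum_le_suminf) auto
      finally show ?thesis .
    qed auto
  qed
  also have "\<dots> = (\<Sum>k. mellin r (g k))"
    unfolding mellin_def by (intro nn_integral_suminf) measurable
  finally show ?thesis .
qed

text \<open>Chebyshev's inequality on \<open>[s/2, s]\<close>, where \<open>h\<close> is at least \<open>h s\<close>.\<close>

lemma mellin_ge:
  assumes h: "antimono h" "0 \<le> h s" and s: "0 < s" and r: "0 < r"
  shows "ennreal ((s / 2) powr r * h s / 2) \<le> mellin r h"
proof -
  have "ennreal ((s / 2) powr r * h s / 2)
      = (\<integral>\<^sup>+u. ennreal ((s / 2) powr r * h s / s) * indicator {s / 2..s} u \<partial>lborel)"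
    using s h(2) by (subst nn_integral_cmult_indicator) (auto simp: ennreal_mult'[symmetric])
  also have "\<dots> \<le> mellin r h"
    unfolding mellin_def
  proof (rule nn_integral_mono)
    fix u :: real
    show "ennreal ((s / 2) powr r * h s / s) * indicator {s / 2..s} u
        \<le> ennreal (u powr r * h u / u) * indicator {0<..} u"
    proof (cases "u \<in> {s / 2..s}")
      case True
      then have "(s / 2) powr r * h s \<le> u powr r * h u"
        using s r h antimonoD[OF h(1), of u s] by (intro mult_mono powr_mono2) auto
      moreover have "0 \<le> u powr r * h u"
        using True h antimonoD[OF h(1), of u s] by auto
      ultimately have "(s / 2) powr r * h s / s \<le> u powr r * h u / u"
        using s True by (intro frac_le) auto
      then show ?thesis using True s by (auto intro!: ennreal_leI)
    qed auto
  qed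
  finally show ?thesis .
qed

text \<open>In the Hardy inequality a factor \<open>\<theta>\<^sup>j\<close> is given away to select one term of a sum. The gap between \<open>a\<close> and
  \<open>r\<close> leaves room for a \<open>\<theta>\<close> close to \<open>1\<close> for which the final series still converges.\<close>

lemma geometric_ratio_exists:
  fixes a r :: real
  assumes a: "0 < a" "a < r"
  obtains \<theta> where "0 < \<theta>" "\<theta> < 1" "(2 / \<theta>) powr a * 2 powr - r < 1"
proof (rule that)
  define \<epsilon> where "\<epsilon> = (r / a - 1) / 2"
  have \<epsilon>: "0 < \<epsilon>" "a * (1 + \<epsilon>) < r" using a by (auto simp: \<epsilon>_def field_simps)
  show "0 < 2 powr - \<epsilon>" "2 powr - \<epsilon> < 1" using \<epsilon>(1) by (auto simp: powr_less_one)
  have "2 / 2 powr - \<epsilon> = 2 powr (1 + \<epsilon>)" by (simp add: powr_add powr_minus field_simps)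
  then have "(2 / 2 powr - \<epsilon>) powr a * 2 powr - r = 2 powr (a * (1 + \<epsilon>) - r)"
    by (simp add: powr_powr powr_add[symmetric] mult.commute)
  also have "\<dots> < 1" using \<epsilon>(2) by (auto intro: powr_less_one)
  finally show "(2 / 2 powr - \<epsilon>) powr a * 2 powr - r < 1" .
qed

text \<open>Some term of the series, say the \<open>j\<close>-th, is at least \<open>\<phi>(2s)\<close> times a small multiple of \<open>\<theta>\<^sup>j\<close>.
  Raising this single inequality to the power \<open>a\<close> costs nothing, whatever \<open>a > 0\<close> is; scaling then
  turns the \<open>j\<close>-th bound into a constant times \<open>\<rho>\<^sup>j\<close> times the Mellin integral of the right-hand side.\<close>

lemma mellin_hardy:
  fixes \<phi> \<psi> :: "real \<Rightarrow> real"
  assumes a: "0 < a" and \<theta>: "0 < \<theta>" "\<theta> < 1" and \<rho>: "\<rho> = (2 / \<theta>) powr a * 2 powr - r" "\<rho> < 1"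
    and [measurable]: "\<phi> \<in> borel_measurable borel" "\<psi> \<in> borel_measurable borel"
    and nonneg: "\<And>s. 0 \<le> \<phi> s" "\<And>s. 0 \<le> \<psi> s"
    and le: "\<And>s. 0 < s \<Longrightarrow> ennreal (\<phi> (2 * s)) \<le> (\<Sum>j. ennreal (2 * 2 ^ j * \<psi> (2 ^ j * s)))"
  shows "mellin r (\<lambda>s. \<phi> s powr a)
      \<le> ennreal (2 powr r * (((1 - \<theta>) / 4) powr - a / (1 - \<rho>))) * mellin r (\<lambda>s. \<psi> s powr a)"
proof -
  define c where "c = (1 - \<theta>) / 4"
  have c: "0 < c" using \<theta> by (simp add: c_def)
  have \<rho>0: "0 < \<rho>" using \<theta> by (simp add: \<rho>(1))
  define g where "g j s = c powr - a * (2 / \<theta>) powr (a * j) * \<psi> (2 ^ j * s) powr a" for j :: nat and s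
  have "\<exists>j. \<phi> (2 * s) powr a \<le> g j s" if s: "0 < s" for s
  proof (cases "\<phi> (2 * s) = 0")
    case True
    then show ?thesis by (intro exI[of _ 0]) (simp add: g_def)
  next
    case False
    define y where "y = \<phi> (2 * s)"
    have y: "0 < y" using False nonneg(1)[of "2 * s"] by (simp add: y_def)
    \<comment> \<open>Otherwise the terms are dominated by a geometric series with sum \<open>y / 2\<close>.\<close>
    have "\<exists>j. c * y * (\<theta> / 2) ^ j \<le> \<psi> (2 ^ j * s)"
    proof (rule ccontr)
      assume "\<not> ?thesis"
      then have small: "\<psi> (2 ^ j * s) \<le> c * y * (\<theta> / 2) ^ j" for j
        by (meson linorder_not_le less_imp_le)
      have "ennreal y \<le> (\<Sum>j. ennreal (2 * 2 ^ j * \<psi> (2 ^ j * s)))"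
        unfolding y_def by (rule le[OF s])
      also have "\<dots> \<le> (\<Sum>j. ennreal (2 * c * y * \<theta> ^ j))"
      proof (intro suminf_le ennreal_leI)
        fix j
        have "2 * 2 ^ j * \<psi> (2 ^ j * s) \<le> 2 * 2 ^ j * (c * y * (\<theta> / 2) ^ j)"
          using small by (intro mult_left_mono) auto
        also have "\<dots> = 2 * c * y * \<theta> ^ j" by (simp add: power_divide)
        finally show "2 * 2 ^ j * \<psi> (2 ^ j * s) \<le> 2 * c * y * \<theta> ^ j" .
      qed auto
      also have "\<dots> = ennreal (2 * c * y * (1 / (1 - \<theta>)))"
        using \<theta> c y by (intro suminf_ennreal_eq sums_mult geometric_sums) auto
      also have "2 * c * y * (1 / (1 - \<theta>)) = y / 2" using \<theta> by (simp add: c_def field_simps)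
      finally show False using y by simp
    qed
    then obtain j where j: "c * y * (\<theta> / 2) ^ j \<le> \<psi> (2 ^ j * s)" by blast
    have "y = (1 / c) * (2 / \<theta>) ^ j * (c * y * (\<theta> / 2) ^ j)"
      using c \<theta> by (simp add: power_divide)
    also have "\<dots> \<le> (1 / c) * (2 / \<theta>) ^ j * \<psi> (2 ^ j * s)"
      using j c \<theta> by (intro mult_left_mono) auto
    finally have "y powr a \<le> ((1 / c) * (2 / \<theta>) ^ j * \<psi> (2 ^ j * s)) powr a"
      using y a by (intro powr_mono2) auto
    also have "\<dots> = g j s"
      using c \<theta> nonneg(2) unfolding g_def
      by (simp add: powr_mult powr_divide powr_minus_divide powr_realpow[symmetric] powr_powr mult.commute)
    finally show ?thesis unfolding y_def by blast
  qed
  moreover have "g j \<in> borel_measurable borel" "0 \<le> g j s" for j s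
    unfolding g_def by auto
  moreover have Mg: "mellin r (g j) = ennreal (c powr - a * \<rho> ^ j) * mellin r (\<lambda>s. \<psi> s powr a)" for j
  proof -
    have "mellin r (g j) = ennreal (c powr - a * (2 / \<theta>) powr (a * j)) * mellin r (\<lambda>s. \<psi> (2 ^ j * s) powr a)"
      unfolding g_def by (intro mellin_cmult) auto
    also have "mellin r (\<lambda>s. \<psi> (2 ^ j * s) powr a)
        = ennreal ((2 ^ j) powr - r) * mellin r (\<lambda>s. \<psi> s powr a)"
      by (rule mellin_scale[of "\<lambda>s. \<psi> s powr a"]) auto
    also have "ennreal (c powr - a * (2 / \<theta>) powr (a * j)) * (ennreal ((2 ^ j) powr - r) * mellin r (\<lambda>s. \<psi> s powr a))
        = ennreal (c powr - a * (2 / \<theta>) powr (a * j) * (2 ^ j) powr - r) * mellin r (\<lambda>s. \<psi> s powr a)"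
      by (simp add: ennreal_mult' mult.assoc)
    also have "c powr - a * (2 / \<theta>) powr (a * j) * (2 ^ j) powr - r = c powr - a * \<rho> ^ j"
      using \<theta> by (simp add: \<rho>(1) power_mult_distrib powr_realpow[symmetric] powr_powr powr_mult mult.commute)
    finally show ?thesis .
  qed
  ultimately have "mellin r (\<lambda>s. \<phi> (2 * s) powr a) \<le> (\<Sum>j. mellin r (g j))"
    by (intro mellin_le_suminf)
  also have "\<dots> = (\<Sum>j. ennreal (c powr - a * \<rho> ^ j) * mellin r (\<lambda>s. \<psi> s powr a))"
    by (simp only: Mg)
  also have "(\<Sum>j. ennreal (c powr - a * \<rho> ^ j) * mellin r (\<lambda>s. \<psi> s powr a))
      = ennreal (c powr - a / (1 - \<rho>)) * mellin r (\<lambda>s. \<psi> s powr a)"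
  proof -
    have "(\<lambda>j. c powr - a * \<rho> ^ j) sums (c powr - a * (1 / (1 - \<rho>)))"
      using \<rho>(2) \<rho>0 by (intro sums_mult geometric_sums) auto
    then have "(\<Sum>j. ennreal (c powr - a * \<rho> ^ j)) = ennreal (c powr - a / (1 - \<rho>))"
      using \<rho>(2) \<rho>0 by (intro suminf_ennreal_eq) auto
    then show ?thesis by (simp add: ennreal_suminf_multc)
  qed
  also have "mellin r (\<lambda>s. \<phi> (2 * s) powr a) = ennreal (2 powr - r) * mellin r (\<lambda>s. \<phi> s powr a)"
    by (rule mellin_scale[of "\<lambda>s. \<phi> s powr a"]) auto
  finally have "ennreal (2 powr r) * (ennreal (2 powr - r) * mellin r (\<lambda>s. \<phi> s powr a))
      \<le> ennreal (2 powr r) * (ennreal (c powr - a / (1 - \<rho>)) * mellin r (\<lambda>s. \<psi> s powr a))"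
    by (rule mult_left_mono) auto
  then show ?thesis
    by (simp add: c_def mult.assoc[symmetric] ennreal_mult'[symmetric] powr_add[symmetric])
qed

text \<open>A geometric series, dominated by its largest term.\<close>

lemma sum_dyadic_powers_below:
  fixes x a :: real
  assumes "0 \<le> x" "0 < a"
  shows "(\<Sum>k. ennreal ((1 / 2 ^ k) powr a * of_bool (1 / 2 ^ k \<le> x))) \<le> ennreal (x powr a / (1 - 2 powr - a))"
proof (cases "x = 0")
  case False
  define \<rho> where "\<rho> = 2 powr - a"
  have \<rho>: "0 < \<rho>" "\<rho> < 1" using assms(2) by (auto simp: \<rho>_def powr_less_one)
  have pow: "(1 / 2 ^ k) powr a = \<rho> ^ k" for k :: nat
    by (simp add: \<rho>_def powr_divide powr_realpow[symmetric] powr_powr powr_minus_divide mult.commute)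
  have "\<exists>k::nat. 1 / 2 ^ k \<le> x"
    using False assms(1) real_arch_pow_inv[of x "1 / 2"] by (fastforce simp: power_one_over intro: less_imp_le)
  define k0 where "k0 = (LEAST k::nat. 1 / 2 ^ k \<le> x)"
  have k0: "1 / 2 ^ k0 \<le> x" unfolding k0_def by (rule LeastI_ex) fact
  have below: "\<not> 1 / 2 ^ k \<le> x" if "k < k0" for k
    using not_less_Least that unfolding k0_def by blast
  have "(\<Sum>k. ennreal ((1 / 2 ^ k) powr a * of_bool (1 / 2 ^ k \<le> x)))
      \<le> (\<Sum>k. ennreal (\<rho> ^ k * of_bool (k0 \<le> k)))"
    using below \<rho> unfolding pow by (intro suminf_le ennreal_leI) (auto simp: not_le[symmetric])
  also have "(\<lambda>k. \<rho> ^ k * of_bool (k0 \<le> k)) sums (\<rho> ^ k0 * (1 / (1 - \<rho>)))"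
  proof -
    have "(\<lambda>k. \<rho> ^ k0 * \<rho> ^ k) sums (\<rho> ^ k0 * (1 / (1 - \<rho>)))"
      using \<rho> by (intro sums_mult geometric_sums) auto
    then have "(\<lambda>k. \<rho> ^ (k + k0) * of_bool (k0 \<le> k + k0)) sums (\<rho> ^ k0 * (1 / (1 - \<rho>)))"
      by (simp add: power_add mult.commute)
    then show ?thesis
      by (subst (asm) sums_iff_shift) simp
  qed
  then have "(\<Sum>k. ennreal (\<rho> ^ k * of_bool (k0 \<le> k))) = ennreal (\<rho> ^ k0 * (1 / (1 - \<rho>)))"
    using \<rho> by (intro suminf_ennreal_eq) auto
  also have "\<dots> \<le> ennreal (x powr a / (1 - \<rho>))"
    using k0 \<rho> assms unfolding pow[symmetric]
    by (intro ennreal_leI) (auto intro!: divide_right_mono powr_mono2)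
  finally show ?thesis by (simp add: \<rho>_def)
next
  case True
  have "(\<Sum>k. ennreal ((1 / 2 ^ k) powr a * of_bool (1 / 2 ^ k \<le> x))) = (\<Sum>k::nat. 0)"
  proof (intro suminf_cong)
    fix k :: nat
    have "\<not> 1 / 2 ^ k \<le> x" using True by (simp add: not_le)
    then show "ennreal ((1 / 2 ^ k) powr a * of_bool (1 / 2 ^ k \<le> x)) = 0" by simp
  qed
  then show ?thesis by simp
qed

text \<open>For \<open>\<psi>\<close> the distribution function of \<open>g\<close>, the hypothesis is what one knows about the distribution
  function \<open>\<phi>\<close> of a product of \<open>g\<close> with a weight whose own distribution function decays like the power
  \<open>-1/\<tau>\<close>, so this is O'Neil's inequality. For each \<open>s\<close> choose a dyadic \<open>\<delta> = 2\<^bsup>-k\<^esup>\<close> comparable to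
  \<open>\<phi>(s)\<close>. Then \<open>\<phi>(s)\<^sup>b\<close> is at most a constant times \<open>\<delta>\<^sup>b\<close>, and \<open>\<delta> \<le> \<psi>(s \<delta>\<^sup>\<tau> / K)\<close>.
  Summing over all \<open>k\<close> with this property and rescaling each integral replaces \<open>\<delta>\<^sup>b\<close> by \<open>\<delta>\<^sup>a\<close>, and
  the sum of \<open>\<delta>\<^sup>a\<close> over \<open>\<delta> \<le> \<psi>(s)\<close> is comparable to \<open>\<psi>(s)\<^sup>a\<close>.\<close>

lemma mellin_product:
  fixes \<phi> \<psi> :: "real \<Rightarrow> real"
  assumes a: "0 < a" and K: "0 < K" and b: "b = a + r * \<tau>" "0 < b"
    and [measurable]: "\<phi> \<in> borel_measurable borel" "\<psi> \<in> borel_measurable borel"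
    and nonneg: "\<And>s. 0 \<le> \<phi> s" "\<And>s. \<phi> s \<le> 1" "\<And>s. 0 \<le> \<psi> s"
    and le: "\<And>s \<delta>. \<lbrakk>0 < s; 0 < \<delta>; \<delta> \<le> 1\<rbrakk> \<Longrightarrow> \<phi> s \<le> 2 * \<delta> + \<psi> (\<delta> powr \<tau> / K * s)"
  shows "mellin r (\<lambda>s. \<phi> s powr b)
      \<le> ennreal (8 powr b * K powr r * (1 / (1 - 2 powr - a))) * mellin r (\<lambda>s. \<psi> s powr a)"
proof -
  define \<rho> where "\<rho> = 2 powr - a"
  have \<rho>: "0 < \<rho>" "\<rho> < 1" using a by (auto simp: \<rho>_def powr_less_one)
  define d where "d k = 1 / (2::real) ^ k" for k :: nat
  have d: "0 < d k" "d k \<le> 1" for k by (auto simp: d_def)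
  define g where "g k s = (8 * d k) powr b * of_bool (d k \<le> \<psi> (d k powr \<tau> / K * s))" for k s
  have "\<exists>k. \<phi> s powr b \<le> g k s" if s: "0 < s" for s
  proof (cases "\<phi> s = 0")
    case True
    then show ?thesis by (intro exI[of _ 0]) (simp add: g_def)
  next
    case False
    define y where "y = \<phi> s"
    have y: "0 < y" "y \<le> 1" using False nonneg(1,2)[of s] by (simp_all add: y_def)
    \<comment> \<open>Balance the two terms of the bound: \<open>d k\<close> is comparable to \<open>y\<close> and takes at most half of it.\<close>
    have ex: "\<exists>k. d k \<le> y / 4"
      using y real_arch_pow_inv[of "y / 4" "1 / 2"] unfolding d_def power_one_over
      by (fastforce intro: less_imp_le)
    define k where "k = (LEAST k. d k \<le> y / 4)"
    have k: "d k \<le> y / 4" unfolding k_def by (rule LeastI_ex) fact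
    have "k \<noteq> 0" using k y by (intro notI) (simp add: d_def)
    then obtain m where m: "k = Suc m" using not0_implies_Suc by blast
    have "\<not> d m \<le> y / 4" using not_less_Least[of m "\<lambda>k. d k \<le> y / 4"] m unfolding k_def by simp
    then have y8: "y \<le> 8 * d k" by (simp add: m d_def)
    have "y \<le> 2 * d k + \<psi> (d k powr \<tau> / K * s)"
      unfolding y_def using s d by (intro le) auto
    then have "d k \<le> \<psi> (d k powr \<tau> / K * s)" using k y by linarith
    moreover have "y powr b \<le> (8 * d k) powr b" using y8 y b by (intro powr_mono2) auto
    ultimately show ?thesis unfolding g_def y_def by (intro exI[of _ k]) simp
  qed
  moreover have "g k \<in> borel_measurable borel" "0 \<le> g k s" for k s
    unfolding g_def by auto
  moreover have Mg: "mellin r (g k) = ennreal (8 powr b * K powr r) * mellin r (\<lambda>s. d k powr a * of_bool (d k \<le> \<psi> s))" for k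
  proof -
    have "mellin r (g k) = ennreal ((8 * d k) powr b) * mellin r (\<lambda>s. of_bool (d k \<le> \<psi> (d k powr \<tau> / K * s)))"
      unfolding g_def by (intro mellin_cmult) auto
    also have "mellin r (\<lambda>s. of_bool (d k \<le> \<psi> (d k powr \<tau> / K * s)))
        = ennreal ((d k powr \<tau> / K) powr - r) * mellin r (\<lambda>s. of_bool (d k \<le> \<psi> s))"
      using d(1)[of k] K by (intro mellin_scale[of "\<lambda>s. of_bool (d k \<le> \<psi> s)"]) auto
    also have "ennreal ((8 * d k) powr b) * (ennreal ((d k powr \<tau> / K) powr - r) * mellin r (\<lambda>s. of_bool (d k \<le> \<psi> s)))
        = ennreal ((8 * d k) powr b * (d k powr \<tau> / K) powr - r) * mellin r (\<lambda>s. of_bool (d k \<le> \<psi> s))"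
      by (simp add: ennreal_mult' mult.assoc)
    also have "(8 * d k) powr b * (d k powr \<tau> / K) powr - r = 8 powr b * K powr r * d k powr a"
    proof -
      have "d k powr b = d k powr a * d k powr (\<tau> * r)" by (simp add: b(1) powr_add mult.commute)
      then show ?thesis using d(1)[of k] K
        by (simp add: powr_mult powr_divide powr_powr powr_minus field_simps)
    qed
    also have "ennreal (8 powr b * K powr r * d k powr a) * mellin r (\<lambda>s. of_bool (d k \<le> \<psi> s))
        = ennreal (8 powr b * K powr r) * mellin r (\<lambda>s. d k powr a * of_bool (d k \<le> \<psi> s))"
      by (subst mellin_cmult) (auto simp: ennreal_mult' mult.assoc)
    finally show ?thesis .
  qed
  ultimately have "mellin r (\<lambda>s. \<phi> s powr b) \<le> (\<Sum>k. mellin r (g k))"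
    by (intro mellin_le_suminf)
  also have "\<dots> = (\<Sum>k. ennreal (8 powr b * K powr r) * mellin r (\<lambda>s. d k powr a * of_bool (d k \<le> \<psi> s)))"
    by (simp only: Mg)
  also have "(\<Sum>k. ennreal (8 powr b * K powr r) * mellin r (\<lambda>s. d k powr a * of_bool (d k \<le> \<psi> s)))
      = ennreal (8 powr b * K powr r) * (\<Sum>k. mellin r (\<lambda>s. d k powr a * of_bool (d k \<le> \<psi> s)))"
    by (rule ennreal_suminf_cmult)
  also have "(\<Sum>k. mellin r (\<lambda>s. d k powr a * of_bool (d k \<le> \<psi> s))) \<le> mellin r (\<lambda>s. (1 / (1 - \<rho>)) * \<psi> s powr a)"
  proof -
    have "(\<Sum>k. mellin r (\<lambda>s. d k powr a * of_bool (d k \<le> \<psi> s)))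
        = (\<integral>\<^sup>+s. (\<Sum>k. ennreal (s powr r * (d k powr a * of_bool (d k \<le> \<psi> s)) / s) * indicator {0<..} s) \<partial>lborel)"
      unfolding mellin_def by (intro nn_integral_suminf[symmetric]) measurable
    also have "\<dots> \<le> mellin r (\<lambda>s. (1 / (1 - \<rho>)) * \<psi> s powr a)"
      unfolding mellin_def
    proof (rule nn_integral_mono)
      fix s :: real
      show "(\<Sum>k. ennreal (s powr r * (d k powr a * of_bool (d k \<le> \<psi> s)) / s) * indicator {0<..} s)
          \<le> ennreal (s powr r * (1 / (1 - \<rho>) * \<psi> s powr a) / s) * indicator {0<..} s"
      proof (cases "0 < s")
        case True
        have "(\<Sum>k. ennreal (s powr r * (d k powr a * of_bool (d k \<le> \<psi> s)) / s) * indicator {0<..} s)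
            = (\<Sum>k. ennreal (s powr r / s) * ennreal (d k powr a * of_bool (d k \<le> \<psi> s)))"
          using True by (intro suminf_cong) (simp add: ennreal_mult'[symmetric])
        also have "\<dots> = ennreal (s powr r / s) * (\<Sum>k. ennreal (d k powr a * of_bool (d k \<le> \<psi> s)))"
          by (rule ennreal_suminf_cmult)
        also have "\<dots> \<le> ennreal (s powr r / s) * ennreal (\<psi> s powr a / (1 - \<rho>))"
          unfolding d_def \<rho>_def using nonneg(3) a
          by (intro mult_left_mono sum_dyadic_powers_below) auto
        finally show ?thesis using True by (simp add: ennreal_mult'[symmetric] mult.commute)
      qed auto
    qed
    finally show ?thesis .
  qed
  also have "mellin r (\<lambda>s. (1 / (1 - \<rho>)) * \<psi> s powr a) = ennreal (1 / (1 - \<rho>)) * mellin r (\<lambda>s. \<psi> s powr a)"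
    using \<rho> by (intro mellin_cmult) auto
  finally have "mellin r (\<lambda>s. \<phi> s powr b)
      \<le> ennreal (8 powr b * K powr r) * (ennreal (1 / (1 - \<rho>)) * mellin r (\<lambda>s. \<psi> s powr a))"
    by (simp add: mult_left_mono)
  then show ?thesis
    using \<rho> unfolding \<rho>_def[symmetric] by (subst ennreal_mult') (auto simp: mult.assoc)
qed

section \<open>Distribution functions\<close>

definition distribution_fun :: "(complex \<Rightarrow> ennreal) \<Rightarrow> real \<Rightarrow> real" where
  "distribution_fun g s = measure disc_area {z\<in>disc. g z > ennreal s}"

lemma superlevel_sets [measurable]:
  fixes g :: "complex \<Rightarrow> ennreal"
  assumes "g \<in> borel_measurable disc_area"
  shows "{z\<in>disc. g z > c} \<in> sets disc_area"
proof -
  have "{z\<in>space disc_area. c < g z} \<in> sets disc_area" using assms by measurable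
  then show ?thesis by simp
qed

lemma distribution_fun_nonneg: "0 \<le> distribution_fun g s"
  by (simp add: distribution_fun_def)

lemma distribution_fun_le_1: "distribution_fun g s \<le> 1"
  using disc_area.bounded_measure[of "{z\<in>disc. g z > ennreal s}"] measure_disc_area_disc
  by (simp add: distribution_fun_def)

lemma antimono_distribution_fun:
  assumes "g \<in> borel_measurable disc_area"
  shows "antimono (distribution_fun g)"
proof (rule antimonoI)
  fix s u :: real assume "s \<le> u"
  then have "{z\<in>disc. g z > ennreal u} \<subseteq> {z\<in>disc. g z > ennreal s}"
    using ennreal_leI by (auto intro: le_less_trans)
  then show "distribution_fun g u \<le> distribution_fun g s"
    unfolding distribution_fun_def using assms
    by (intro disc_area.finite_measure_mono superlevel_sets)
qed

lemma distribution_fun_measurable: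
  assumes "g \<in> borel_measurable disc_area"
  shows "distribution_fun g \<in> borel_measurable borel"
proof -
  have "mono (\<lambda>s. - distribution_fun g s)"
    using antimono_distribution_fun[OF assms] by (auto simp: mono_def antimono_def)
  then have "(\<lambda>s. - (- distribution_fun g s)) \<in> borel_measurable borel"
    by (intro borel_measurable_uminus borel_measurable_mono)
  then show ?thesis by simp
qed

text \<open>The set where \<open>F = \<infinity>\<close> lies in every superlevel set, and their measures tend to \<open>0\<close>.\<close>

lemma AE_finite_of_distribution_decay:
  assumes F: "F \<in> borel_measurable disc_area" and r: "0 < r" and b: "0 < b"
    and le: "\<And>s. 0 < s \<Longrightarrow> s powr r * distribution_fun F s powr b \<le> B"
  shows "AE z in disc_area. F z < \<infinity>"
proof -
  define m where "m = measure disc_area {z\<in>space disc_area. F z = \<infinity>}"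
  have "m = 0"
  proof (rule ccontr)
    assume "m \<noteq> 0"
    then have m: "0 < m" by (simp add: m_def less_le)
    have "0 \<le> 1 powr r * distribution_fun F 1 powr b" by simp
    then have B: "0 \<le> B" using le[of 1] by linarith
    define s where "s = ((B + 1) / m powr b) powr (1 / r)"
    have s: "0 < s" "s powr r = (B + 1) / m powr b"
      using m B r by (auto simp: s_def powr_powr)
    have "m \<le> distribution_fun F s"
      unfolding m_def distribution_fun_def
      by (intro disc_area.finite_measure_mono superlevel_sets F) auto
    then have "s powr r * m powr b \<le> s powr r * distribution_fun F s powr b"
      using m b by (intro mult_left_mono powr_mono2) auto
    then have "B + 1 \<le> B" using le[OF s(1)] s(2) m by simp
    then show False by simp
  qed
  moreover have S: "{z\<in>space disc_area. \<not> F z < \<infinity>} \<in> sets disc_area" using F by measurable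
  ultimately have "emeasure disc_area {z\<in>space disc_area. \<not> F z < \<infinity>} = 0"
    unfolding m_def by (simp add: disc_area.emeasure_eq_measure not_less top_unique)
  then show ?thesis
    by (intro AE_I[OF subset_refl] S)
qed

lemma epowr_mono:
  assumes "x \<le> y" "0 \<le> a"
  shows "epowr x a \<le> epowr y a"
  using assms by (auto simp: epowr_def top_unique less_top intro!: ennreal_leI powr_mono2 enn2real_mono)

lemma epowr_cmult:
  assumes "0 < c"
  shows "epowr (ennreal c * x) a = ennreal (c powr a) * epowr x a"
  using assms by (auto simp: epowr_def ennreal_mult_eq_top_iff enn2real_mult powr_mult ennreal_mult
    ennreal_mult_top)

lemma epowr_less_top_iff: "epowr x a < \<infinity> \<longleftrightarrow> x < \<infinity>"
  by (auto simp: epowr_def less_top)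

lemma epowr_ennreal: "0 \<le> x \<Longrightarrow> epowr (ennreal x) a = ennreal (x powr a)"
  by (simp add: epowr_def)

lemma lorentz_norm_eq_mellin:
  "lorentz_norm p r g = epowr (ennreal p * mellin r (\<lambda>s. distribution_fun g s powr (r / p))) (1 / r)"
  by (simp add: lorentz_norm_def mellin_def distribution_fun_def)

section \<open>The averaging maximal function\<close>

definition truncate_below :: "real \<Rightarrow> (complex \<Rightarrow> complex) \<Rightarrow> complex \<Rightarrow> complex" where
  "truncate_below s f z = (if norm (f z) > s then f z else 0)"

lemma truncate_below_measurable:
  assumes [measurable]: "f \<in> borel_measurable disc_area"
  shows "truncate_below s f \<in> borel_measurable disc_area"
  unfolding truncate_below_def by measurable

lemma carleson_box_pos:
  assumes "dyadic_system \<D>" "I \<in> \<D>"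
  shows "0 < measure disc_area (carleson_box I)"
proof -
  have "0 < (arc_measure I)\<^sup>2 / 64" using dyadic_arc(2)[OF assms] by simp
  also have "\<dots> \<le> measure disc_area (carleson_box I)"
    by (rule measure_carleson_box_ge[OF dyadic_arc[OF assms]])
  finally show ?thesis .
qed

text \<open>Averages over a box are monotone and \<open>|f|\<close> is at most \<open>s\<close> plus the part of it above \<open>s\<close>.\<close>

lemma maximal_op_le_truncation:
  assumes \<D>: "dyadic_system \<D>" and f [measurable]: "f \<in> borel_measurable disc_area" and s: "0 < s"
  shows "maximal_op 1 \<D> f z \<le> ennreal s + maximal_op 1 \<D> (truncate_below s f) z"
  unfolding maximal_op_def[of 1 \<D> f]
proof (rule SUP_least)
  fix I assume "I \<in> {I\<in>\<D>. z \<in> carleson_box I}"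
  then have I: "I \<in> \<D>" "z \<in> carleson_box I" by auto
  let ?Q = "carleson_box I" and ?g = "truncate_below s f"
  have Q [measurable]: "?Q \<in> sets disc_area" using carleson_box_sets dyadic_arc(1)[OF \<D> I(1)] .
  note [measurable] = truncate_below_measurable[OF f, of s]
  define m where "m = measure disc_area ?Q"
  have m: "0 < m" unfolding m_def by (rule carleson_box_pos[OF \<D> I(1)])
  have "(\<integral>\<^sup>+w\<in>?Q. ennreal (norm (f w)) \<partial>disc_area)
      \<le> (\<integral>\<^sup>+w. ennreal s * indicator ?Q w + ennreal (norm (?g w)) * indicator ?Q w \<partial>disc_area)"
    using s by (intro nn_integral_mono)
      (auto simp: truncate_below_def not_less intro!: ennreal_leI split: split_indicator)
  also have "\<dots> = ennreal s * ennreal m + (\<integral>\<^sup>+w\<in>?Q. ennreal (norm (?g w)) \<partial>disc_area)"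
    by (subst nn_integral_add) (auto simp: nn_integral_cmult_indicator m_def disc_area.emeasure_eq_measure)
  finally have "(\<integral>\<^sup>+w\<in>?Q. ennreal (norm (f w)) \<partial>disc_area) / ennreal m
      \<le> (ennreal s * ennreal m + (\<integral>\<^sup>+w\<in>?Q. ennreal (norm (?g w)) \<partial>disc_area)) / ennreal m"
    by (rule divide_right_mono_ennreal)
  also have "\<dots> = ennreal s + (\<integral>\<^sup>+w\<in>?Q. ennreal (norm (?g w)) \<partial>disc_area) / ennreal m"
    using m by (simp add: add_divide_distrib_ennreal ennreal_mult_divide_eq)
  also have "\<dots> \<le> ennreal s + maximal_op 1 \<D> ?g z"
    unfolding maximal_op_def using I m
    by (intro add_left_mono SUP_upper2[of I]) (auto simp: m_def)
  finally show "(\<integral>\<^sup>+w\<in>?Q. ennreal (norm (f w)) \<partial>disc_area) / ennreal (measure disc_area ?Q powr 1)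
      \<le> ennreal s + maximal_op 1 \<D> ?g z"
    using m by (simp add: m_def)
qed

lemma distribution_maximal_op_le:
  assumes \<D>: "dyadic_system \<D>" and f: "f \<in> borel_measurable disc_area" and s: "0 < s"
  shows "ennreal s * ennreal (distribution_fun (maximal_op 1 \<D> f) (2 * s))
      \<le> (\<integral>\<^sup>+z. ennreal (norm (truncate_below s f z)) \<partial>disc_area)"
proof -
  let ?g = "truncate_below s f"
  have g: "?g \<in> borel_measurable disc_area" by (rule truncate_below_measurable[OF f])
  have "{z\<in>disc. maximal_op 1 \<D> f z > ennreal (2 * s)} \<subseteq> {z\<in>disc. maximal_op 1 \<D> ?g z > ennreal s}"
  proof safe
    fix z assume "maximal_op 1 \<D> f z > ennreal (2 * s)"
    also have "ennreal (2 * s) = ennreal s + ennreal s" using s by (simp flip: ennreal_plus)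
    finally have "ennreal s + ennreal s < ennreal s + maximal_op 1 \<D> ?g z"
      using maximal_op_le_truncation[OF \<D> f s, of z] by (rule less_le_trans)
    then show "maximal_op 1 \<D> ?g z > ennreal s" by (simp add: ennreal_add_left_cancel_less)
  qed
  then have "emeasure disc_area {z\<in>disc. maximal_op 1 \<D> f z > ennreal (2 * s)}
      \<le> emeasure disc_area {z\<in>disc. maximal_op 1 \<D> ?g z > ennreal s}"
    by (intro emeasure_mono superlevel_sets maximal_op_measurable \<D>)
  then have "ennreal s * ennreal (distribution_fun (maximal_op 1 \<D> f) (2 * s))
      \<le> ennreal s * emeasure disc_area {z\<in>disc. maximal_op 1 \<D> ?g z > ennreal s}"
    unfolding distribution_fun_def disc_area.emeasure_eq_measure by (intro mult_left_mono) auto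
  also have "\<dots> \<le> (\<integral>\<^sup>+z. ennreal (norm (?g z)) \<partial>disc_area)"
    by (rule maximal_op_weak_type_1_1[OF \<D> g s])
  finally show ?thesis .
qed

text \<open>A value of \<open>|f|\<close> in the range from \<open>2\<^sup>j s\<close> to \<open>2\<^bsup>j+1\<^esup> s\<close> is paid for by the \<open>j\<close>-th term of the series.\<close>

lemma truncated_integral_le_suminf:
  assumes f [measurable]: "f \<in> borel_measurable disc_area" and s: "0 < s"
  shows "(\<integral>\<^sup>+z. ennreal (norm (truncate_below s f z)) \<partial>disc_area)
      \<le> ennreal s * (\<Sum>j. ennreal (2 * 2 ^ j * distribution_fun (\<lambda>z. ennreal (norm (f z))) (2 ^ j * s)))"
proof -
  define E where "E j = {z\<in>disc. ennreal (norm (f z)) > ennreal (2 ^ j * s)}" for j :: nat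
  have [measurable]: "E j \<in> sets disc_area" for j unfolding E_def by measurable
  have "(\<integral>\<^sup>+z. ennreal (norm (truncate_below s f z)) \<partial>disc_area)
      \<le> (\<integral>\<^sup>+z. (\<Sum>j. ennreal (s * (2 * 2 ^ j)) * indicator (E j) z) \<partial>disc_area)"
  proof (rule nn_integral_mono)
    fix z assume "z \<in> space disc_area"
    then have z: "z \<in> disc" by simp
    show "ennreal (norm (truncate_below s f z)) \<le> (\<Sum>j. ennreal (s * (2 * 2 ^ j)) * indicator (E j) z)"
    proof (cases "norm (f z) > s")
      case True
      have "\<exists>j::nat. norm (f z) \<le> 2 * 2 ^ j * s"
      proof -
        obtain n where "norm (f z) / s < 2 ^ n" using real_arch_pow[of 2 "norm (f z) / s"] by auto
        then have "norm (f z) < 2 ^ n * s" using s by (simp add: field_simps)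
        also have "\<dots> \<le> 2 * 2 ^ n * s" using s by simp
        finally show ?thesis by (auto intro: less_imp_le)
      qed
      define j where "j = (LEAST j::nat. norm (f z) \<le> 2 * 2 ^ j * s)"
      have j: "norm (f z) \<le> 2 * 2 ^ j * s" unfolding j_def by (rule LeastI_ex) fact
      have "2 ^ j * s < norm (f z)"
      proof (cases j)
        case (Suc i)
        then have "\<not> norm (f z) \<le> 2 * 2 ^ i * s"
          using not_less_Least[of i "\<lambda>j. norm (f z) \<le> 2 * 2 ^ j * s"] unfolding j_def by simp
        then show ?thesis using Suc by simp
      qed (use True in simp)
      then have "z \<in> E j" using z s unfolding E_def by (simp add: ennreal_less_iff)
      then have "ennreal (norm (truncate_below s f z)) \<le> ennreal (s * (2 * 2 ^ j)) * indicator (E j) z"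
        using j by (auto simp: truncate_below_def mult.commute intro!: ennreal_leI)
      also have "\<dots> = (\<Sum>i\<in>{j}. ennreal (s * (2 * 2 ^ i)) * indicator (E i) z)"
        by (simp del: sum_mult_indicator)
      also have "\<dots> \<le> (\<Sum>j. ennreal (s * (2 * 2 ^ j)) * indicator (E j) z)"
        by (rule sum_le_suminf) auto
      finally show ?thesis .
    qed (simp add: truncate_below_def)
  qed
  also have "\<dots> = (\<Sum>j. ennreal (s * (2 * 2 ^ j)) * emeasure disc_area (E j))"
    by (subst nn_integral_suminf) (auto simp: nn_integral_cmult_indicator)
  also have "\<dots> = (\<Sum>j. ennreal s * ennreal (2 * 2 ^ j * distribution_fun (\<lambda>z. ennreal (norm (f z))) (2 ^ j * s)))"
    using s by (intro suminf_cong)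
      (simp add: disc_area.emeasure_eq_measure E_def distribution_fun_def mult.assoc flip: ennreal_mult')
  also have "\<dots> = ennreal s * (\<Sum>j. ennreal (2 * 2 ^ j * distribution_fun (\<lambda>z. ennreal (norm (f z))) (2 ^ j * s)))"
    by (rule ennreal_suminf_cmult)
  finally show ?thesis .
qed

lemma distribution_maximal_op_le_suminf:
  assumes "dyadic_system \<D>" "f \<in> borel_measurable disc_area" "0 < s"
  shows "ennreal (distribution_fun (maximal_op 1 \<D> f) (2 * s))
      \<le> (\<Sum>j. ennreal (2 * 2 ^ j * distribution_fun (\<lambda>z. ennreal (norm (f z))) (2 ^ j * s)))"
  using order_trans[OF distribution_maximal_op_le[OF assms] truncated_integral_le_suminf[OF assms(2,3)]] assms(3)
  by (subst (asm) ennreal_mult_le_mult_iff) auto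

text \<open>The weak type \<open>(p,p)\<close> bound follows from weak type \<open>(1,1)\<close>, since above height \<open>u\<close> the
  modulus \<open>|f|\<close> is at most \<open>u\<^bsup>1-p\<^esup> |f|\<^sup>p\<close>.\<close>

lemma distribution_maximal_op_le_power:
  assumes \<D>: "dyadic_system \<D>" and f [measurable]: "f \<in> borel_measurable disc_area" and s: "0 < s" and p: "1 < p"
    and A: "(\<integral>\<^sup>+z. ennreal (norm (f z) powr p) \<partial>disc_area) = ennreal A" "0 \<le> A"
  shows "distribution_fun (maximal_op 1 \<D> f) s \<le> (s / 2) powr - p * A"
proof -
  define u where "u = s / 2"
  have u: "0 < u" using s by (simp add: u_def)
  have "ennreal u * ennreal (distribution_fun (maximal_op 1 \<D> f) (2 * u))
      \<le> (\<integral>\<^sup>+z. ennreal (norm (truncate_below u f z)) \<partial>disc_area)"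
    by (rule distribution_maximal_op_le[OF \<D> f u])
  also have "\<dots> \<le> (\<integral>\<^sup>+z. ennreal (u powr (1 - p)) * ennreal (norm (f z) powr p) \<partial>disc_area)"
  proof (rule nn_integral_mono)
    fix z
    show "ennreal (norm (truncate_below u f z)) \<le> ennreal (u powr (1 - p)) * ennreal (norm (f z) powr p)"
    proof (cases "norm (f z) > u")
      case True
      then have "norm (f z) = norm (f z) powr (1 - p) * norm (f z) powr p"
        using u by (simp flip: powr_add)
      also have "\<dots> \<le> u powr (1 - p) * norm (f z) powr p"
        using True u p by (intro mult_right_mono powr_mono2') auto
      finally show ?thesis using True
        by (simp add: truncate_below_def flip: ennreal_mult')
    qed (simp add: truncate_below_def)
  qed
  also have "\<dots> = ennreal (u powr (1 - p)) * ennreal A"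
    unfolding A(1)[symmetric] by (intro nn_integral_cmult) measurable
  finally have "u * distribution_fun (maximal_op 1 \<D> f) (2 * u) \<le> u powr (1 - p) * A"
    using u A(2) by (simp add: distribution_fun_nonneg flip: ennreal_mult')
  also have "u powr (1 - p) = u * u powr - p" using u by (simp add: powr_diff powr_minus field_simps)
  finally show ?thesis using u by (simp add: u_def)
qed

section \<open>The hypersingular maximal function\<close>

text \<open>Every box containing \<open>z\<close> belongs to an arc of length at least \<open>1 - |z|\<close>, hence has area at least
  \<open>\<delta>\<^sup>2 / 64\<close>. This is where the exponent \<open>2t - 2\<close> comes from: it is \<open>t - 1\<close> powers of the
  area.\<close>

lemma maximal_op_le_weight:
  assumes \<D>: "dyadic_system \<D>" and t: "1 < t" and \<delta>: "0 < \<delta>" "\<delta> \<le> 1 - norm z"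
  shows "maximal_op t \<D> f z \<le> ennreal (64 powr (t - 1) / \<delta> powr (2 * t - 2)) * maximal_op 1 \<D> f z"
  unfolding maximal_op_def[of t \<D> f]
proof (rule SUP_least)
  fix I assume "I \<in> {I\<in>\<D>. z \<in> carleson_box I}"
  then have I: "I \<in> \<D>" "z \<in> carleson_box I" by auto
  define m where "m = measure disc_area (carleson_box I)"
  define K where "K = 64 powr (t - 1) / \<delta> powr (2 * t - 2)"
  let ?a = "\<integral>\<^sup>+w\<in>carleson_box I. ennreal (norm (f w)) \<partial>disc_area"
  have "\<delta> \<le> arc_measure I" using I(2) \<delta>(2) by (auto simp: carleson_box_def)
  then have "\<delta>\<^sup>2 / 64 \<le> (arc_measure I)\<^sup>2 / 64" using \<delta>(1) by (auto intro: power_mono)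
  also have "\<dots> \<le> m" unfolding m_def by (rule measure_carleson_box_ge[OF dyadic_arc[OF \<D> I(1)]])
  finally have m: "\<delta>\<^sup>2 / 64 \<le> m" .
  then have m0: "0 < m" using \<delta>(1) by (smt (verit) zero_less_divide_iff zero_less_power)
  have "1 / m powr t = m powr - (t - 1) * (1 / m)"
    using m0 by (simp add: powr_minus powr_diff field_simps)
  also have "\<dots> \<le> (\<delta>\<^sup>2 / 64) powr - (t - 1) * (1 / m)"
    using m m0 t \<delta>(1) by (intro mult_right_mono powr_mono2') auto
  also have "(\<delta>\<^sup>2 / 64) powr - (t - 1) = K"
  proof -
    have "\<delta>\<^sup>2 = \<delta> powr 2" using \<delta>(1) by simp
    then show ?thesis using \<delta>(1) unfolding K_def
      by (simp add: powr_divide powr_powr powr_minus field_simps del: powr_numeral)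
         (simp add: powr_diff field_simps)
  qed
  finally have le: "1 / m powr t \<le> K * (1 / m)" .
  have "?a / ennreal (m powr t) = ?a * ennreal (1 / m powr t)"
    using m0 by (simp add: divide_ennreal_def inverse_ennreal inverse_eq_divide)
  also have "\<dots> \<le> ?a * ennreal (K * (1 / m))" by (intro mult_left_mono ennreal_leI le) auto
  also have "\<dots> = ennreal K * (?a / ennreal (m powr 1))"
  proof -
    have "ennreal (K * (1 / m)) = ennreal K * ennreal (1 / m)"
      using m0 by (intro ennreal_mult) (auto simp: K_def)
    moreover have "?a / ennreal (m powr 1) = ?a * ennreal (1 / m)"
      using m0 by (simp add: divide_ennreal_def inverse_ennreal inverse_eq_divide)
    ultimately show ?thesis by (simp only: mult_ac)
  qed
  also have "\<dots> \<le> ennreal K * maximal_op 1 \<D> f z"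
    unfolding maximal_op_def m_def using I by (intro mult_left_mono SUP_upper2[of I]) auto
  finally show "?a / ennreal (measure disc_area (carleson_box I) powr t)
      \<le> ennreal (64 powr (t - 1) / \<delta> powr (2 * t - 2)) * maximal_op 1 \<D> f z"
    by (simp add: m_def K_def)
qed

text \<open>The annulus of width \<open>\<delta>\<close> along the circle is given away; outside it the weight is at most a
  constant times \<open>\<delta>\<^bsup>-\<tau>\<^esup>\<close>, with \<open>\<tau> = 2t - 2\<close>.\<close>

lemma distribution_maximal_op_hypersingular_le:
  assumes \<D>: "dyadic_system \<D>" and t: "1 < t" and s: "0 < s" and \<delta>: "0 < \<delta>" "\<delta> \<le> 1"
  shows "distribution_fun (maximal_op t \<D> f) s
      \<le> 2 * \<delta> + distribution_fun (maximal_op 1 \<D> f) (\<delta> powr (2 * t - 2) / 64 powr (t - 1) * s)"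
proof -
  define K where "K = 64 powr (t - 1) / \<delta> powr (2 * t - 2)"
  have K: "0 < K" using \<delta> by (simp add: K_def)
  let ?A = "{z\<in>disc. 1 - norm z < \<delta>}" and ?B = "{z\<in>disc. maximal_op 1 \<D> f z > ennreal (s / K)}"
  have A: "?A \<in> sets disc_area"
  proof -
    have "?A = disc - cball 0 (1 - \<delta>)" by auto
    then show ?thesis unfolding sets_disc_area by auto
  qed
  have B: "?B \<in> sets disc_area" by (intro superlevel_sets maximal_op_measurable \<D>)
  have "{z\<in>disc. maximal_op t \<D> f z > ennreal s} \<subseteq> ?A \<union> ?B"
  proof
    fix z assume "z \<in> {z\<in>disc. maximal_op t \<D> f z > ennreal s}"
    then have z: "z \<in> disc" "maximal_op t \<D> f z > ennreal s" by auto
    have "z \<in> ?B" if "\<not> 1 - norm z < \<delta>"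
    proof -
    have "ennreal s < ennreal K * maximal_op 1 \<D> f z"
      using less_le_trans[OF z(2) maximal_op_le_weight[OF \<D> t \<delta>(1)]] that by (simp add: K_def not_less)
    also have "ennreal s = ennreal K * ennreal (s / K)"
      using K s by (simp flip: ennreal_mult')
    finally have "maximal_op 1 \<D> f z > ennreal (s / K)"
      by (meson mult_left_mono not_le zero_le)
    then show ?thesis using z(1) by simp
    qed
    then show "z \<in> ?A \<union> ?B" using z(1) by auto
  qed
  then have "distribution_fun (maximal_op t \<D> f) s \<le> measure disc_area (?A \<union> ?B)"
    unfolding distribution_fun_def using A B by (intro disc_area.finite_measure_mono) auto
  also have "\<dots> \<le> measure disc_area ?A + measure disc_area ?B"
    by (rule measure_Un_le[OF A B])
  also have "\<dots> \<le> 2 * \<delta> + distribution_fun (maximal_op 1 \<D> f) (s / K)"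
    unfolding distribution_fun_def using measure_near_circle_le[OF \<delta>] by simp
  also have "s / K = \<delta> powr (2 * t - 2) / 64 powr (t - 1) * s" by (simp add: K_def)
  finally show ?thesis .
qed

text \<open>With \<open>a = r / p\<close> and \<open>b = r / q\<close> the relation between the exponents reads \<open>b = a + r \<tau>\<close>, and
  \<open>p > 1\<close> is the condition \<open>a < r\<close> of the Hardy inequality.\<close>

lemma maximal_op_lorentz_bounded:
  assumes \<D>: "dyadic_system \<D>" and t: "1 < t" and p: "1 < p" and q: "0 < q"
    and pq: "1 / q - 1 / p = 2 * t - 2" and r: "0 < r"
  shows "bounded_op (lorentz_norm p r) (lorentz_norm q r) (maximal_op t \<D>)"
proof -
  define a where "a = r / p"
  have a: "0 < a" "a < r" using p r by (auto simp: a_def field_simps)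
  have "1 / q = 1 / p + (2 * t - 2)" using pq by simp
  then have "r * (1 / q) = r * (1 / p + (2 * t - 2))" by simp
  then have b: "r / q = a + r * (2 * t - 2)" unfolding a_def by (simp add: distrib_left)
  have b0: "0 < r / q" using r q by simp
  have K: "0 < (64::real) powr (t - 1)" by simp
  obtain \<theta> where \<theta>: "0 < \<theta>" "\<theta> < 1" "(2 / \<theta>) powr a * 2 powr - r < 1"
    by (rule geometric_ratio_exists[OF a])
  define C1 where "C1 = 2 powr r * (((1 - \<theta>) / 4) powr - a / (1 - (2 / \<theta>) powr a * 2 powr - r))"
  note hardy = mellin_hardy[OF a(1) \<theta>(1,2) refl \<theta>(3), folded C1_def]
  have C1: "0 \<le> C1" using \<theta> by (simp add: C1_def)
  define C2 where "C2 = 8 powr (r / q) * (64 powr (t - 1)) powr r * (1 / (1 - 2 powr - a))"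
  note product = mellin_product[OF a(1) K b b0, folded C2_def]
  have C2: "0 \<le> C2" using a by (simp add: C2_def powr_le_one_le less_imp_le powr_less_one)
  \<comment> \<open>The constant is kept positive so that it can be pulled out of \<open>epowr\<close> also at \<open>\<infinity>\<close>.\<close>
  define C where "C = C2 * C1 + 1"
  have C: "0 < C" using C1 C2 by (simp add: C_def add_nonneg_pos)
  show ?thesis
    unfolding bounded_op_def
  proof (intro exI[of _ "(q * C / p) powr (1 / r)"] conjI ballI impI)
    show "0 \<le> (q * C / p) powr (1 / r)" by simp
    fix f :: "complex \<Rightarrow> complex"
    assume f: "f \<in> borel_measurable disc_area" and fin: "lorentz_norm p r (\<lambda>z. ennreal (norm (f z))) < \<infinity>"
    let ?F = "maximal_op t \<D> f" and ?M = "maximal_op 1 \<D> f" and ?f = "\<lambda>z. ennreal (norm (f z))"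
    show F: "?F \<in> borel_measurable disc_area" by (rule maximal_op_measurable[OF \<D>])
    have M: "?M \<in> borel_measurable disc_area" by (rule maximal_op_measurable[OF \<D>])
    have f': "?f \<in> borel_measurable disc_area" using f by measurable
    let ?\<Lambda> = "mellin r (\<lambda>s. distribution_fun ?f s powr a)"
    let ?\<Lambda>' = "mellin r (\<lambda>s. distribution_fun ?F s powr (r / q))"
    have "?\<Lambda>' \<le> ennreal C2 * mellin r (\<lambda>s. distribution_fun ?M s powr a)"
      by (intro product distribution_fun_measurable F M distribution_fun_nonneg distribution_fun_le_1
          distribution_maximal_op_hypersingular_le \<D> t)
    also have "\<dots> \<le> ennreal C2 * (ennreal C1 * ?\<Lambda>)"
      by (intro mult_left_mono hardy distribution_fun_measurable M f' distribution_fun_nonneg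
          distribution_maximal_op_le_suminf \<D> f) auto
    also have "\<dots> = ennreal (C2 * C1) * ?\<Lambda>" using C1 C2 by (simp add: ennreal_mult mult.assoc)
    also have "\<dots> \<le> ennreal C * ?\<Lambda>" by (intro mult_right_mono ennreal_leI) (auto simp: C_def)
    finally have le: "?\<Lambda>' \<le> ennreal C * ?\<Lambda>" .
    have "?\<Lambda> < \<infinity>"
      using fin p unfolding lorentz_norm_eq_mellin epowr_less_top_iff a_def
      by (auto simp: ennreal_mult_less_top)
    then have "?\<Lambda>' < \<infinity>" using le by (auto simp: ennreal_mult_less_top intro: le_less_trans)
    then obtain L where L: "?\<Lambda>' = ennreal L" "0 \<le> L" by (cases "?\<Lambda>'") auto
    show "AE z in disc_area. ?F z < \<infinity>"
    proof (rule AE_finite_of_distribution_decay[OF F r b0])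
      fix s :: real assume s: "0 < s"
      have "antimono (\<lambda>s. distribution_fun ?F s powr (r / q))"
        using antimono_distribution_fun[OF F] b0
        by (auto simp: antimono_def distribution_fun_nonneg intro!: powr_mono2)
      from mellin_ge[OF this _ s r] have "ennreal ((s / 2) powr r * distribution_fun ?F s powr (r / q) / 2) \<le> ennreal L"
        unfolding L(1) by simp
      then have "(s / 2) powr r * distribution_fun ?F s powr (r / q) / 2 \<le> L" using L(2) by simp
      then show "s powr r * distribution_fun ?F s powr (r / q) \<le> 2 * 2 powr r * L"
        using s by (simp add: powr_divide field_simps)
    qed
    have "lorentz_norm q r ?F \<le> epowr (ennreal q * (ennreal C * ?\<Lambda>)) (1 / r)"
      unfolding lorentz_norm_eq_mellin using r by (intro epowr_mono mult_left_mono le) auto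
    also have "ennreal q * (ennreal C * ?\<Lambda>) = ennreal (q * C / p) * (ennreal p * ?\<Lambda>)"
      using p q C by (simp add: mult.assoc[symmetric] flip: ennreal_mult)
    also have "epowr \<dots> (1 / r) = ennreal ((q * C / p) powr (1 / r)) * lorentz_norm p r ?f"
      unfolding lorentz_norm_eq_mellin a_def using p q C by (intro epowr_cmult) auto
    finally show "lorentz_norm q r ?F \<le> ennreal ((q * C / p) powr (1 / r)) * lorentz_norm p r ?f" .
  qed
qed

text \<open>With \<open>y\<close> the value at \<open>s\<close> of the distribution function of \<open>M\<^sub>t f\<close>, the choice \<open>\<delta> = y / 4\<close> yields
  \<open>y / 2 \<le> C A (s y\<^sup>\<tau>)\<^bsup>-p\<^esup>\<close>, where \<open>A\<close> is the integral of \<open>|f|\<^sup>p\<close>; solving for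
  \<open>s y\<^bsup>1/q\<^esup>\<close> is possible because \<open>1/q = 1/p + \<tau>\<close>.\<close>

lemma maximal_op_weak_bounded:
  assumes \<D>: "dyadic_system \<D>" and t: "1 < t" and p: "1 < p" and q: "0 < q"
    and pq: "1 / q - 1 / p = 2 * t - 2"
  shows "bounded_op (Lp_norm p) (weak_norm q) (maximal_op t \<D>)"
proof -
  define \<tau> where "\<tau> = 2 * t - 2"
  define K where "K = (64::real) powr (t - 1)"
  have K: "0 < K" by (simp add: K_def)
  define C where "C = 2 * K * 4 powr \<tau> * 2 powr (1 / p)"
  have C: "0 \<le> C" using K by (simp add: C_def)
  show ?thesis
    unfolding bounded_op_def
  proof (intro exI[of _ C] conjI ballI impI C)
    fix f :: "complex \<Rightarrow> complex"
    assume f: "f \<in> borel_measurable disc_area" and fin: "Lp_norm p (\<lambda>z. ennreal (norm (f z))) < \<infinity>"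
    let ?F = "maximal_op t \<D> f" and ?M = "maximal_op 1 \<D> f" and ?f = "\<lambda>z. ennreal (norm (f z))"
    show F: "?F \<in> borel_measurable disc_area" by (rule maximal_op_measurable[OF \<D>])
    have Lp: "Lp_norm p ?f = epowr (\<integral>\<^sup>+z. ennreal (norm (f z) powr p) \<partial>disc_area) (1 / p)"
      unfolding Lp_norm_def by (simp add: epowr_ennreal)
    then obtain A where A: "(\<integral>\<^sup>+z. ennreal (norm (f z) powr p) \<partial>disc_area) = ennreal A" "0 \<le> A"
      using fin by (cases "\<integral>\<^sup>+z. ennreal (norm (f z) powr p) \<partial>disc_area") (auto simp: epowr_def)
    have norm: "Lp_norm p ?f = ennreal (A powr (1 / p))"
      unfolding Lp A(1) using A(2) by (rule epowr_ennreal)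
    have weak: "s * distribution_fun ?F s powr (1 / q) \<le> C * A powr (1 / p)" if s: "0 < s" for s
    proof (cases "distribution_fun ?F s = 0")
      case True
      then show ?thesis using C by simp
    next
      case False
      define y where "y = distribution_fun ?F s"
      have y: "0 < y" "y \<le> 1"
        using False distribution_fun_nonneg[of ?F s] distribution_fun_le_1[of ?F s] by (auto simp: y_def)
      define u where "u = (y / 4) powr \<tau> / K * s"
      have u: "0 < u" using y K s by (simp add: u_def)
      have "y \<le> 2 * (y / 4) + distribution_fun ?M u"
        unfolding y_def u_def K_def \<tau>_def
        by (rule distribution_maximal_op_hypersingular_le[OF \<D> t s]) (use y in \<open>auto simp: y_def\<close>)
      also have "distribution_fun ?M u \<le> (u / 2) powr - p * A"
        by (rule distribution_maximal_op_le_power[OF \<D> f u p A])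
      finally have "y / 2 \<le> (u / 2) powr - p * A" by simp
      then have "(u / 2) powr p * y \<le> 2 * A"
        using u by (simp add: powr_minus field_simps)
      then have "((u / 2) powr p * y) powr (1 / p) \<le> (2 * A) powr (1 / p)"
        using y p by (intro powr_mono2) auto
      then have "(u / 2) * y powr (1 / p) \<le> 2 powr (1 / p) * A powr (1 / p)"
        using u y p A(2) by (simp add: powr_mult powr_powr)
      moreover have "(u / 2) * y powr (1 / p) = s * y powr (1 / q) / (2 * K * 4 powr \<tau>)"
      proof -
        have "1 / q = \<tau> + 1 / p" using pq by (simp add: \<tau>_def)
        then have "y powr (1 / q) = y powr \<tau> * y powr (1 / p)" by (simp only: powr_add)
        then show ?thesis using y by (simp add: u_def powr_divide mult_ac)
      qed
      ultimately have "s * y powr (1 / q) / (2 * K * 4 powr \<tau>) \<le> 2 powr (1 / p) * A powr (1 / p)"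
        by (simp only:)
      then have "s * y powr (1 / q) \<le> 2 powr (1 / p) * A powr (1 / p) * (2 * K * 4 powr \<tau>)"
        using K by (subst (asm) pos_divide_le_eq) auto
      then show ?thesis by (simp add: C_def y_def mult_ac)
    qed
    show "AE z in disc_area. ?F z < \<infinity>"
      using weak q by (intro AE_finite_of_distribution_decay[OF F, of 1 "1 / q" "C * A powr (1 / p)"]) auto
    show "weak_norm q ?F \<le> ennreal C * Lp_norm p ?f"
      unfolding weak_norm_def norm using C weak
      by (intro SUP_least) (auto simp: distribution_fun_def intro!: ennreal_leI simp flip: ennreal_mult')
  qed
qed

theorem corollary3p7:
  fixes t p q :: real and \<D> :: "complex set set"
  assumes "1 < t" and "t < 3 / 2"
    and "dyadic_system \<D>"
    and "1 / p \<in> {0<..<1}" and "1 / q \<in> {0<..<1}"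
    and "1 / q - 1 / p = 2 * t - 2"
  shows "(\<forall>r>0. bounded_op (lorentz_norm p r) (lorentz_norm q r) (maximal_op t \<D>)) \<and>
         bounded_op (Lp_norm p) (weak_norm q) (maximal_op t \<D>)"
proof -
  have "1 < p" "0 < q" using assms(4,5) by (auto simp: field_simps)
  then show ?thesis
    using maximal_op_lorentz_bounded[OF assms(3,1)] maximal_op_weak_bounded[OF assms(3,1)] assms(6) by blast
qed

end
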